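(* Let $(\mathcal{A},\alpha,\gamma)$ be a graded $C^*$-dynamical system, $\beta\in\mathbb{R}\setminus\{0\}$, and let $\omega$ be extremal in the convex set $\mathcal{S}_\beta(\mathcal{A},\alpha,\gamma)$ of $\gamma$-invariant $(\alpha,\beta)$-KMS states. Then the convex set $\mathcal{F}_\beta(\mathcal{A},\alpha,\gamma,\omega)$ has at most two extremal points.
   Context: All $C^*$-algebras are unital. A graded $C^*$-dynamical system $(\mathcal{A},\alpha,\gamma)$ consists of a $C^*$-algebra $\mathcal{A}$, a strongly continuous action $\alpha$ of $\mathbb{R}$ on $\mathcal{A}$ by automorphisms, and an automorphism $\gamma$ with $\gamma^2=\mathrm{id}$ and $\alpha_t\circ\gamma=\gamma\circ\alpha_t$ for all $t$. $\mathcal{A}_\alpha$ is the ${}^*$-subalgebra of entire analytic elements for $\alpha$. A state $\omega$ is an $(\alpha,\beta)$-KMS state if $\omega(a\alpha_{i\beta}(b))=\omega(ba)$ for all $a,b\in\mathcal{A}_\alpha$; $\mathcal{S}_\beta(\mathcal{A},\alpha,\gamma)$ is the set of $\gamma$-invariant $(\alpha,\beta)$-KMS states. $\mathcal{F}_\beta(\mathcal{A},\alpha,\gamma,\omega)$ is the set of linear functionals $\rho$ on $\mathcal{A}$ such that: $\rho(a\alpha_{i\beta}(b))=\rho(b\gamma(a))$ for all $a,b\in\mathcal{A}_\alpha$; $\overline{\rho(a^* )}=\rho(a)$ for all $a\in\mathcal{A}$; and $|\rho(a^*b)|^2\le\omega(a^*a)\omega(b^*b)$ for all $a,b\in\mathcal{A}$.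 *)

theory Defs
  imports "HOL-Analysis.Analysis" "HOL-Library.Function_Algebras"
begin

text \<open>
  The class \<open>real_normed_algebra_1\<close> demands \<open>norm 1 = 1\<close>, which every non-zero unital
  C*-algebra satisfies; only the zero algebra, which carries no state, is excluded.
\<close>

class unital_cstar_algebra = real_normed_algebra_1 + banach +
  fixes scaleC :: "complex \<Rightarrow> 'a \<Rightarrow> 'a"  (infixr \<open>*\<^sub>C\<close> 75)
    and adj :: "'a \<Rightarrow> 'a"
  assumes scaleC_add_right: "c *\<^sub>C (a + b) = c *\<^sub>C a + c *\<^sub>C b"
    and scaleC_add_left: "(c + d) *\<^sub>C a = c *\<^sub>C a + d *\<^sub>C a"
    and scaleC_scaleC: "c *\<^sub>C d *\<^sub>C a = (c * d) *\<^sub>C a"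
    and scaleC_of_real: "complex_of_real r *\<^sub>C a = r *\<^sub>R a"
    and mult_scaleC_left: "(c *\<^sub>C a) * b = c *\<^sub>C (a * b)"
    and mult_scaleC_right: "a * (c *\<^sub>C b) = c *\<^sub>C (a * b)"
    and norm_scaleC: "norm (c *\<^sub>C a) = cmod c * norm a"
    and adj_adj: "adj (adj a) = a"
    and adj_add: "adj (a + b) = adj a + adj b"
    and adj_scaleC: "adj (c *\<^sub>C a) = cnj c *\<^sub>C adj a"
    and adj_mult: "adj (a * b) = adj b * adj a"
    and cstar_identity: "norm (adj a * a) = (norm a)\<^sup>2"

text \<open>
  Functions into a real vector space form a real vector space pointwise. This makes
  \<open>convex\<close> and \<open>extreme_point_of\<close> available for sets of linear functionals.
\<close>

instantiation "fun" :: (type, real_vector) real_vector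
begin

definition scaleR_fun :: "real \<Rightarrow> ('a \<Rightarrow> 'b) \<Rightarrow> 'a \<Rightarrow> 'b"
  where "scaleR_fun r f = (\<lambda>x. r *\<^sub>R f x)"

instance
  by standard (simp_all add: scaleR_fun_def plus_fun_def scaleR_add_right scaleR_add_left)

end

lemma scaleR_fun_apply [simp]: "(r *\<^sub>R f) x = r *\<^sub>R f x"
  for f :: "'a \<Rightarrow> 'b :: real_vector"
  by (simp add: scaleR_fun_def)

definition star_automorphism :: "('a :: unital_cstar_algebra \<Rightarrow> 'a) \<Rightarrow> bool"
  where "star_automorphism \<phi> \<longleftrightarrow>
    bij \<phi> \<and>
    (\<forall>a b. \<phi> (a + b) = \<phi> a + \<phi> b) \<and>
    (\<forall>c a. \<phi> (c *\<^sub>C a) = c *\<^sub>C \<phi> a) \<and>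
    (\<forall>a b. \<phi> (a * b) = \<phi> a * \<phi> b) \<and>
    (\<forall>a. \<phi> (adj a) = adj (\<phi> a))"

definition strongly_continuous_action :: "(real \<Rightarrow> 'a :: unital_cstar_algebra \<Rightarrow> 'a) \<Rightarrow> bool"
  where "strongly_continuous_action \<alpha> \<longleftrightarrow>
    (\<forall>t. star_automorphism (\<alpha> t)) \<and>
    \<alpha> 0 = id \<and>
    (\<forall>s t. \<alpha> (s + t) = \<alpha> s \<circ> \<alpha> t) \<and>
    (\<forall>a. continuous_on UNIV (\<lambda>t. \<alpha> t a))"

definition graded_cstar_dynamical_system ::
    "(real \<Rightarrow> 'a :: unital_cstar_algebra \<Rightarrow> 'a) \<Rightarrow> ('a \<Rightarrow> 'a) \<Rightarrow> bool"
  where "graded_cstar_dynamical_system \<alpha> \<gamma> \<longleftrightarrow>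
    strongly_continuous_action \<alpha> \<and>
    star_automorphism \<gamma> \<and>
    \<gamma> \<circ> \<gamma> = id \<and>
    (\<forall>t. \<alpha> t \<circ> \<gamma> = \<gamma> \<circ> \<alpha> t)"

text \<open>
  The library's \<open>holomorphic_on\<close> requires values in a field, so complex differentiability
  of algebra-valued functions is expressed by a complex-linear Frechet derivative.
\<close>

definition entire :: "(complex \<Rightarrow> 'a :: unital_cstar_algebra) \<Rightarrow> bool"
  where "entire f \<longleftrightarrow> (\<forall>z. \<exists>d. (f has_derivative (\<lambda>h. h *\<^sub>C d)) (at z))"

definition analytic_extension ::
    "(real \<Rightarrow> 'a :: unital_cstar_algebra \<Rightarrow> 'a) \<Rightarrow> 'a \<Rightarrow> (complex \<Rightarrow> 'a) \<Rightarrow> bool"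
  where "analytic_extension \<alpha> a f \<longleftrightarrow> entire f \<and> (\<forall>t. f (complex_of_real t) = \<alpha> t a)"

definition entire_elements :: "(real \<Rightarrow> 'a :: unital_cstar_algebra \<Rightarrow> 'a) \<Rightarrow> 'a set"
  where "entire_elements \<alpha> = {a. \<exists>f. analytic_extension \<alpha> a f}"

text \<open>
  \<open>complex_time \<alpha> z a\<close> is \<open>\<alpha>\<^sub>z(a)\<close> for \<open>a \<in> entire_elements \<alpha>\<close>; the choice is immaterial
  because, by the identity theorem, the entire extension is unique. For other \<open>a\<close> the
  value is arbitrary and never used.
\<close>

definition complex_time :: "(real \<Rightarrow> 'a :: unital_cstar_algebra \<Rightarrow> 'a) \<Rightarrow> complex \<Rightarrow> 'a \<Rightarrow> 'a"
  where "complex_time \<alpha> z a = (SOME f. analytic_extension \<alpha> a f) z"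

definition linear_functional :: "('a :: unital_cstar_algebra \<Rightarrow> complex) \<Rightarrow> bool"
  where "linear_functional \<rho> \<longleftrightarrow>
    (\<forall>a b. \<rho> (a + b) = \<rho> a + \<rho> b) \<and> (\<forall>c a. \<rho> (c *\<^sub>C a) = c * \<rho> a)"

definition state :: "('a :: unital_cstar_algebra \<Rightarrow> complex) \<Rightarrow> bool"
  where "state \<omega> \<longleftrightarrow>
    linear_functional \<omega> \<and> (\<forall>a. \<omega> (adj a * a) \<in> \<real>\<^sub>\<ge>\<^sub>0) \<and> \<omega> 1 = 1"

definition KMS_state ::
    "(real \<Rightarrow> 'a :: unital_cstar_algebra \<Rightarrow> 'a) \<Rightarrow> real \<Rightarrow> ('a \<Rightarrow> complex) \<Rightarrow> bool"
  where "KMS_state \<alpha> \<beta> \<omega> \<longleftrightarrow>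
    state \<omega> \<and>
    (\<forall>a\<in>entire_elements \<alpha>. \<forall>b\<in>entire_elements \<alpha>.
       \<omega> (a * complex_time \<alpha> (\<i> * complex_of_real \<beta>) b) = \<omega> (b * a))"

definition invariant_KMS_states ::
    "real \<Rightarrow> (real \<Rightarrow> 'a :: unital_cstar_algebra \<Rightarrow> 'a) \<Rightarrow> ('a \<Rightarrow> 'a) \<Rightarrow> ('a \<Rightarrow> complex) set"
  where "invariant_KMS_states \<beta> \<alpha> \<gamma> = {\<omega>. KMS_state \<alpha> \<beta> \<omega> \<and> \<omega> \<circ> \<gamma> = \<omega>}"

text \<open>
  In the last condition \<open>Re\<close> only converts types: for a state \<open>\<omega>\<close> the numbers
  \<open>\<omega> (adj a * a)\<close> are real.
\<close>

definition twisted_KMS_functionals ::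
    "real \<Rightarrow> (real \<Rightarrow> 'a :: unital_cstar_algebra \<Rightarrow> 'a) \<Rightarrow> ('a \<Rightarrow> 'a) \<Rightarrow>
     ('a \<Rightarrow> complex) \<Rightarrow> ('a \<Rightarrow> complex) set"
  where "twisted_KMS_functionals \<beta> \<alpha> \<gamma> \<omega> = {\<rho>.
    linear_functional \<rho> \<and>
    (\<forall>a\<in>entire_elements \<alpha>. \<forall>b\<in>entire_elements \<alpha>.
       \<rho> (a * complex_time \<alpha> (\<i> * complex_of_real \<beta>) b) = \<rho> (b * \<gamma> a)) \<and>
    (\<forall>a. cnj (\<rho> (adj a)) = \<rho> a) \<and>
    (\<forall>a b. (cmod (\<rho> (adj a * b)))\<^sup>2 \<le> Re (\<omega> (adj a * a)) * Re (\<omega> (adj b * b)))}"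

lemma convex_invariant_KMS_states: "convex (invariant_KMS_states \<beta> \<alpha> \<gamma>)"
  unfolding convex_def invariant_KMS_states_def KMS_state_def state_def linear_functional_def
  by (auto simp: fun_eq_iff algebra_simps complex_nonneg_Reals_iff scaleR_conv_of_real
        simp flip: of_real_add)

lemma convex_twisted_KMS_functionals: "convex (twisted_KMS_functionals \<beta> \<alpha> \<gamma> \<omega>)"
proof (rule convexI)
  fix \<rho> \<sigma> and u v :: real
  assume \<rho>: "\<rho> \<in> twisted_KMS_functionals \<beta> \<alpha> \<gamma> \<omega>" and \<sigma>: "\<sigma> \<in> twisted_KMS_functionals \<beta> \<alpha> \<gamma> \<omega>"
    and uv: "0 \<le> u" "0 \<le> v" "u + v = 1"
  have bound: "(cmod ((u *\<^sub>R \<rho> + v *\<^sub>R \<sigma>) (adj a * b)))\<^sup>2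
      \<le> Re (\<omega> (adj a * a)) * Re (\<omega> (adj b * b))" (is "_ \<le> ?B") for a b
  proof -
    have 1: "(cmod (\<rho> (adj a * b)))\<^sup>2 \<le> ?B" and 2: "(cmod (\<sigma> (adj a * b)))\<^sup>2 \<le> ?B"
      using \<rho> \<sigma> by (auto simp: twisted_KMS_functionals_def)
    have B: "0 \<le> ?B" by (rule order_trans[OF zero_le_power2 1])
    have "cmod ((u *\<^sub>R \<rho> + v *\<^sub>R \<sigma>) (adj a * b))
        \<le> u * cmod (\<rho> (adj a * b)) + v * cmod (\<sigma> (adj a * b))"
      using norm_triangle_ineq[of "u *\<^sub>R \<rho> (adj a * b)" "v *\<^sub>R \<sigma> (adj a * b)"] uv by simp
    also have "\<dots> \<le> u * sqrt ?B + v * sqrt ?B"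
      using uv 1 2 by (intro add_mono mult_left_mono real_le_rsqrt) auto
    also have "\<dots> = sqrt ?B"
      using uv(3) by (simp flip: distrib_right)
    finally have "(cmod ((u *\<^sub>R \<rho> + v *\<^sub>R \<sigma>) (adj a * b)))\<^sup>2 \<le> (sqrt ?B)\<^sup>2"
      by (intro power_mono) auto
    then show ?thesis using B by simp
  qed
  show "u *\<^sub>R \<rho> + v *\<^sub>R \<sigma> \<in> twisted_KMS_functionals \<beta> \<alpha> \<gamma> \<omega>"
    using \<rho> \<sigma> bound
    unfolding twisted_KMS_functionals_def linear_functional_def
    by (auto simp: algebra_simps scaleR_conv_of_real)
qed

end

theory Submission
  imports Defs "HOL-Complex_Analysis.Complex_Analysis"
begin

text \<open>
  Let \<open>(H, \<pi>, \<Omega>)\<close> be the GNS representation of \<open>\<omega>\<close>. For the twisted functionals, the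
  bound by \<open>\<omega>\<close> and hermiticity say that each of them is \<open>\<rho>(a) = \<langle>\<Omega>, T\<^sub>\<rho> \<pi>(a)\<Omega>\<rangle>\<close> with a self-adjoint contraction \<open>T\<^sub>\<rho>\<close>
  in the commutant of \<open>\<pi>\<close>. The twisted KMS condition makes \<open>T\<^sub>\<rho> U\<^sub>\<gamma>\<close> an element of the bicommutant,
  where \<open>U\<^sub>\<gamma>\<close> is the unitary that implements \<open>\<gamma>\<close> and commutes with \<open>T\<^sub>\<rho>\<close>. Therefore
  \<open>T\<^sub>\<rho> T\<^sub>\<sigma> = T\<^sub>\<rho> U\<^sub>\<gamma> T\<^sub>\<sigma> U\<^sub>\<gamma>\<close> lies in the centre and is invariant under \<open>\<gamma>\<close>. Extremality of \<open>\<omega>\<close> makes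
  such elements scalars. In particular \<open>T\<^sub>\<rho>\<^sup>2 = l\<close> and \<open>T\<^sub>\<rho> T\<^sub>\<sigma> = k\<close>, so that \<open>l T\<^sub>\<sigma> = k T\<^sub>\<rho>\<close>: the twisted
  functionals form a convex subset of a real line, which has at most two extreme points.

  The argument is carried out without the Hilbert space and without modular theory. The vector
  \<open>T\<^sub>\<rho>\<Omega>\<close> is replaced by a sequence \<open>c\<^sub>n\<close> of algebra elements with \<open>\<bar>\<omega>(c\<^sub>n\<^sup>*x) - \<rho>(x)\<bar> \<le> \<epsilon>\<^sub>n \<parallel>x\<parallel>\<^sub>\<omega>\<close>, and
  \<open>T\<^sub>\<rho> T\<^sub>\<sigma>\<close> by the functional \<open>product \<rho> \<sigma>\<close>, the limit of \<open>\<omega>(c\<^sub>n\<^sup>* x d\<^sub>n)\<close>. The key lemma \<open>product_KMS\<close>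
  states that this functional satisfies the KMS condition. Its proof has three ingredients:
  twisted functionals are \<open>\<alpha>\<close>-invariant (Liouville's theorem, \<open>periodic_functional_invariant\<close>); hence
  the \<open>c\<^sub>n\<close> may be smoothed with a Gaussian and become entire, with \<open>\<alpha>\<^sub>z(c\<^sub>n)\<close> still converging
  to the same vector (\<open>analytic_approximation\<close>); and right multiplication by an entire element is
  bounded for the GNS seminorm (\<open>right_mult_bounded\<close>). Finally \<open>product_scalar\<close> applies extremality and
  \<open>proportional_of_scalar_products\<close> compares two twisted functionals.

  The C*-algebraic facts behind this, isometry of automorphisms and continuity of states, both come
  from square roots of \<open>1 - h\<close> for small self-adjoint \<open>h\<close>.
\<close>

section \<open>Unital C*-algebras\<close>

lemma scaleC_one [simp]: "1 *\<^sub>C a = a" for a :: "'a :: unital_cstar_algebra"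
  using scaleC_of_real[of 1 a] by simp

lemma scaleC_zero_left [simp]: "0 *\<^sub>C a = 0" for a :: "'a :: unital_cstar_algebra"
  using scaleC_of_real[of 0 a] by simp

lemma scaleC_minus_one: "(-1) *\<^sub>C a = - a" for a :: "'a :: unital_cstar_algebra"
  using scaleC_of_real[of "-1" a] by simp

lemma bounded_bilinear_scaleC: "bounded_bilinear (\<lambda>c (a :: 'a :: unital_cstar_algebra). c *\<^sub>C a)"
proof
  fix r :: real and c :: complex and a :: 'a
  show "(r *\<^sub>R c) *\<^sub>C a = r *\<^sub>R (c *\<^sub>C a)"
    by (simp add: scaleC_scaleC scaleR_conv_of_real[of r c] flip: scaleC_of_real)
  show "c *\<^sub>C (r *\<^sub>R a) = r *\<^sub>R (c *\<^sub>C a)"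
    by (simp add: scaleC_scaleC mult.commute flip: scaleC_of_real)
  show "\<exists>K. \<forall>c (a :: 'a). norm (c *\<^sub>C a) \<le> norm c * norm a * K"
    by (rule exI[of _ 1]) (simp add: norm_scaleC)
qed (simp_all add: scaleC_add_left scaleC_add_right)

interpretation scaleC: bounded_bilinear "\<lambda>c (a :: 'a :: unital_cstar_algebra). c *\<^sub>C a"
  by (rule bounded_bilinear_scaleC)

lemma adj_scaleR: "adj (r *\<^sub>R a) = r *\<^sub>R adj a" for a :: "'a :: unital_cstar_algebra"
  using adj_scaleC[of "complex_of_real r" a] by (simp add: scaleC_of_real)

lemma adj_zero [simp]: "adj (0 :: 'a :: unital_cstar_algebra) = 0"
  using adj_scaleR[of 0 "0 :: 'a"] by simp

lemma adj_minus: "adj (- a) = - adj a" for a :: "'a :: unital_cstar_algebra"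
  using adj_scaleR[of "-1" a] by simp

lemma adj_diff: "adj (a - b) = adj a - adj b" for a b :: "'a :: unital_cstar_algebra"
  using adj_add[of a "-b"] by (simp add: adj_minus)

lemma adj_one [simp]: "adj (1 :: 'a :: unital_cstar_algebra) = 1"
  by (metis adj_adj adj_mult mult.right_neutral)

lemma adj_power: "adj (a ^ n) = adj a ^ n" for a :: "'a :: unital_cstar_algebra"
  by (induction n) (simp_all add: adj_mult power_commutes)

lemma norm_adj [simp]: "norm (adj a) = norm a" for a :: "'a :: unital_cstar_algebra"
proof -
  have le: "norm b \<le> norm (adj b)" for b :: 'a
  proof (cases "b = 0")
    case False
    have "norm b * norm b \<le> norm (adj b) * norm b"
      using norm_mult_ineq[of "adj b" b] by (simp add: cstar_identity power2_eq_square)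
    with False show ?thesis by simp
  qed simp
  show ?thesis using le[of a] le[of "adj a"] by (simp add: adj_adj)
qed

lemma bounded_linear_adj: "bounded_linear (adj :: 'a :: unital_cstar_algebra \<Rightarrow> 'a)"
  by (rule bounded_linear_intro[of _ 1]) (simp_all add: adj_add adj_scaleR)

lemma norm_power_two_power:
  fixes a :: "'a :: unital_cstar_algebra"
  assumes "adj a = a"
  shows "norm (a ^ (2 ^ j)) = norm a ^ (2 ^ j)"
proof (induction j)
  case (Suc j)
  have "norm (a ^ (2 ^ Suc j)) = norm (adj (a ^ (2 ^ j)) * a ^ (2 ^ j))"
    by (simp add: adj_power assms power_add mult_2)
  with Suc show ?case by (simp add: cstar_identity power_add mult_2 power2_eq_square)
qed simp

text \<open>
  \<open>1 - w\<close> is the wanted root exactly when \<open>w\<close> is a fixed point of \<open>w \<mapsto> (h + w\<^sup>2) / 2\<close>, which is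
  a contraction of the ball of radius \<open>1/2\<close>. Self-adjointness of \<open>w\<close> and commutation with the
  commutant of \<open>h\<close> are closed conditions that this map preserves, so they may be built into
  the domain of the contraction.
\<close>

lemma sqrt_one_minus_exists:
  fixes h :: "'a :: unital_cstar_algebra"
  assumes h: "adj h = h" "norm h \<le> 1/4"
  obtains y where "adj y = y" "y * y = 1 - h" "\<And>k. k * h = h * k \<Longrightarrow> k * y = y * k"
proof -
  define S where "S = cball 0 (1/2) \<inter> {w. adj w = w} \<inter> (\<Inter>k\<in>{k. k * h = h * k}. {w. k * w = w * k})"
  define T where "T w = (1/2) *\<^sub>R (h + w * w)" for w
  have contr: "norm (w * w - v * v) \<le> norm (w - v)" if "norm w \<le> 1/2" "norm v \<le> 1/2" for w v :: 'a
  proof -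
    have "w * w - v * v = w * (w - v) + (w - v) * v" by (simp add: algebra_simps)
    then have "norm (w * w - v * v) \<le> norm w * norm (w - v) + norm (w - v) * norm v"
      by (metis norm_triangle_mono norm_mult_ineq)
    also have "\<dots> \<le> (1/2) * norm (w - v) + norm (w - v) * (1/2)"
      using that by (intro add_mono mult_right_mono mult_left_mono) auto
    finally show ?thesis by simp
  qed
  have "closed {w :: 'a. adj w = w}"
    by (intro closed_Collect_eq linear_continuous_on bounded_linear_adj continuous_on_id)
  moreover have "closed {w :: 'a. k * w = w * k}" for k
    by (intro closed_Collect_eq continuous_intros)
  ultimately have "closed S"
    unfolding S_def by (intro closed_Int closed_INT closed_cball) auto
  then have "complete S" by (simp add: complete_eq_closed)
  moreover have "0 \<in> S" by (simp add: S_def)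
  moreover have "T w \<in> S" if "w \<in> S" for w
  proof -
    have w: "norm w \<le> 1/2" "adj w = w" and k: "k * w = w * k" if "k * h = h * k" for k
      using \<open>w \<in> S\<close> that unfolding S_def by auto
    have "norm (w * w) \<le> 1/2 * (1/2)"
      using norm_mult_ineq[of w w] mult_mono[of "norm w" "1/2" "norm w" "1/2"] w[of 1] by simp
    then have "norm (T w) \<le> 1/2"
      using norm_triangle_ineq[of h "w * w"] h by (simp add: T_def)
    moreover have "adj (T w) = T w"
      using w[of 1] by (simp add: T_def adj_scaleR adj_add adj_mult h)
    moreover have "k * T w = T w * k" if "k * h = h * k" for k
    proof -
      have "k * (w * w) = w * w * k" by (metis k[OF that] mult.assoc)
      then show ?thesis by (simp add: T_def distrib_left distrib_right that)
    qed
    ultimately show ?thesis unfolding S_def by simp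
  qed
  moreover have "dist (T w) (T v) \<le> 1/2 * dist w v" if "w \<in> S" "v \<in> S" for w v
  proof -
    have "norm w \<le> 1/2" "norm v \<le> 1/2" using that unfolding S_def by auto
    then show ?thesis
      using contr[of w v] by (simp add: T_def dist_norm flip: scaleR_diff_right)
  qed
  ultimately obtain w where "w \<in> S" and Tw: "T w = w"
    using Banach_fix[of S "1/2" T] by (auto simp: image_subset_iff)
  have w: "adj w = w" and k: "k * w = w * k" if "k * h = h * k" for k
    using \<open>w \<in> S\<close> that unfolding S_def by auto
  show ?thesis
  proof (rule that[of "1 - w"])
    show "adj (1 - w) = 1 - w" using w[of 1] by (simp add: adj_diff)
    have "h + w * w = 2 *\<^sub>R T w" by (simp add: T_def)
    then have "h + w * w = w + w" by (simp add: Tw scaleR_2)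
    then show "(1 - w) * (1 - w) = 1 - h" by (simp add: algebra_simps)
    show "k * (1 - w) = (1 - w) * k" if "k * h = h * k" for k
      by (simp add: left_diff_distrib right_diff_distrib k[OF that])
  qed
qed

lemma le_of_two_powers_le:
  fixes r s K :: real
  assumes "\<And>j. r ^ (2 ^ j) \<le> K * s ^ (2 ^ j)" "0 \<le> s"
  shows "r \<le> s"
proof (rule ccontr)
  assume "\<not> r \<le> s"
  then have rs: "s < r" by simp
  show False
  proof (cases "s = 0")
    case True
    with assms(1)[of 0] rs show False by simp
  next
    case False
    with assms(2) have "0 < s" by simp
    then have "1 < r / s" using rs by simp
    then obtain n where n: "K < (r / s) ^ n" using real_arch_pow by blast
    have "n \<le> 2 ^ n" by (simp add: less_imp_le)
    then have "(r / s) ^ n \<le> (r / s) ^ (2 ^ n)"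
      using \<open>1 < r / s\<close> by (intro power_increasing) auto
    also have "\<dots> \<le> K"
      using assms(1)[of n] \<open>0 < s\<close> by (simp add: power_divide pos_divide_le_eq)
    finally show False using n by simp
  qed
qed

section \<open>Automorphisms are isometric\<close>

lemma star_automorphismD:
  assumes "star_automorphism \<phi>"
  shows "bij \<phi>" "\<phi> (a + b) = \<phi> a + \<phi> b" "\<phi> (c *\<^sub>C a) = c *\<^sub>C \<phi> a" "\<phi> (a * b) = \<phi> a * \<phi> b"
    "\<phi> (adj a) = adj (\<phi> a)" "\<phi> (r *\<^sub>R a) = r *\<^sub>R \<phi> a" "\<phi> (a - b) = \<phi> a - \<phi> b" "\<phi> 1 = 1"
proof -
  note D = assms[unfolded star_automorphism_def]
  show "bij \<phi>" "\<phi> (a + b) = \<phi> a + \<phi> b" and C: "\<phi> (c *\<^sub>C a) = c *\<^sub>C \<phi> a" for c a b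
    using D by auto
  show "\<phi> (a * b) = \<phi> a * \<phi> b" "\<phi> (adj a) = adj (\<phi> a)" using D by auto
  show "\<phi> (r *\<^sub>R a) = r *\<^sub>R \<phi> a"
    using C[of "complex_of_real r" a] by (simp add: scaleC_of_real)
  have "\<phi> (a - b) = \<phi> a + \<phi> ((-1) *\<^sub>C b)" using D by (metis scaleC_minus_one diff_conv_add_uminus)
  then show "\<phi> (a - b) = \<phi> a - \<phi> b" unfolding C by (simp add: scaleC_minus_one)
  obtain u where "\<phi> u = 1" using D by (metis bij_pointE)
  moreover have "\<phi> (1 * u) = \<phi> 1 * \<phi> u" using D by blast
  ultimately show "\<phi> 1 = 1" by simp
qed

text \<open>
  If \<open>h\<close> is small and self-adjoint, \<open>1 - h\<^sup>2 = y\<^sup>2\<close> with \<open>y\<close> self-adjoint and commuting with \<open>h\<close>.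
  Under \<open>\<phi>\<close> this becomes \<open>k\<^sup>2 + l\<^sup>2 = 1\<close>, so \<open>k \<plusminus> \<i> l\<close> is unitary and its self-adjoint part \<open>k\<close>
  has norm at most one. This bounds \<open>\<phi>\<close> by \<open>2\<close> on self-adjoint elements; applied to the powers
  \<open>h ^ 2 ^ j\<close>, it loses the factor.
\<close>

lemma star_automorphism_norm_le:
  assumes \<phi>: "star_automorphism \<phi>"
  shows "norm (\<phi> a) \<le> norm a"
proof -
  note D = star_automorphismD[OF \<phi>]
  have half: "norm (\<phi> h) \<le> 1" if h: "adj h = h" "norm h \<le> 1/2" for h
  proof -
    have "norm (h * h) \<le> 1/2 * (1/2)"
      using norm_mult_ineq[of h h] mult_mono[of "norm h" "1/2" "norm h" "1/2"] h by simp
    then obtain y where y: "adj y = y" "y * y = 1 - h * h" "h * y = y * h"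
      using sqrt_one_minus_exists[of "h * h"] h by (auto simp: adj_mult mult.assoc)
    define k l where "k = \<phi> h" and "l = \<phi> y"
    have kl: "adj k = k" "adj l = l" "l * l = 1 - k * k" "k * l = l * k"
      unfolding k_def l_def using h(1) y by (metis D(4,5,7,8))+
    have unitary: "norm (k + c *\<^sub>C l) = 1" if "c = \<i> \<or> c = - \<i>" for c
    proof -
      have "adj (k + c *\<^sub>C l) * (k + c *\<^sub>C l) = 1"
      proof -
        have "adj (k + c *\<^sub>C l) * (k + c *\<^sub>C l)
            = k * k + (c + cnj c) *\<^sub>C (l * k) + (cnj c * c) *\<^sub>C (l * l)"
          by (simp add: adj_add adj_scaleC kl(1,2,4) distrib_left distrib_right mult_scaleC_left scaleC_add_right
              mult_scaleC_right scaleC_scaleC scaleC_add_left mult.commute[of c])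
        also have "\<dots> = 1" using that kl(3) by auto
        finally show ?thesis .
      qed
      then show ?thesis
        using cstar_identity[of "k + c *\<^sub>C l"] norm_ge_zero[of "k + c *\<^sub>C l"]
        by (auto simp del: norm_ge_zero simp: power2_eq_1_iff)
    qed
    have "2 *\<^sub>R k = (k + \<i> *\<^sub>C l) + (k + (- \<i>) *\<^sub>C l)"
      by (simp add: scaleR_2 scaleC.minus_left)
    then have "norm (2 *\<^sub>R k) \<le> 1 + 1"
      using norm_triangle_ineq[of "k + \<i> *\<^sub>C l" "k + (- \<i>) *\<^sub>C l"] unitary by metis
    then show ?thesis by (simp add: k_def)
  qed
  have two: "norm (\<phi> h) \<le> 2 * norm h" if h: "adj h = h" for h
  proof (cases "h = 0")
    case True
    then show ?thesis using D(6)[of 0 h] by simp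
  next
    case False
    define r where "r = 1 / (2 * norm h)"
    have "norm (\<phi> (r *\<^sub>R h)) \<le> 1"
      using False by (intro half) (auto simp: adj_scaleR h r_def)
    with False show ?thesis
      by (simp add: D(6) r_def field_simps)
  qed
  have sa: "norm (\<phi> h) \<le> norm h" if h: "adj h = h" for h
  proof (rule le_of_two_powers_le)
    fix j :: nat
    have pow: "\<phi> (h ^ n) = \<phi> h ^ n" for n by (induction n) (simp_all add: D)
    have "norm (\<phi> h) ^ (2 ^ j) = norm (\<phi> (h ^ (2 ^ j)))"
      using norm_power_two_power[of "\<phi> h" j] h D(5)[of h] by (simp add: pow)
    also have "\<dots> \<le> 2 * norm (h ^ (2 ^ j))" by (rule two) (simp add: adj_power h)
    also have "\<dots> = 2 * norm h ^ (2 ^ j)" by (simp add: norm_power_two_power h)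
    finally show "norm (\<phi> h) ^ (2 ^ j) \<le> 2 * norm h ^ (2 ^ j)" .
  qed simp
  have "(norm (\<phi> a))\<^sup>2 = norm (\<phi> (adj a * a))" by (simp add: D cstar_identity)
  also have "\<dots> \<le> (norm a)\<^sup>2"
    using sa[of "adj a * a"] by (simp add: adj_mult adj_adj cstar_identity)
  finally show ?thesis by (rule power2_le_imp_le) simp
qed

lemma star_automorphism_bounded_linear:
  assumes "star_automorphism \<phi>"
  shows "bounded_linear \<phi>"
  by (rule bounded_linear_intro[of _ 1])
    (simp_all add: star_automorphismD[OF assms] star_automorphism_norm_le[OF assms])

section \<open>Linear functionals and states\<close>

lemma linear_functionalD:
  assumes "linear_functional \<phi>"
  shows "\<phi> (a + b) = \<phi> a + \<phi> b" "\<phi> (c *\<^sub>C a) = c * \<phi> a" "\<phi> (r *\<^sub>R a) = complex_of_real r * \<phi> a"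
    "\<phi> 0 = 0" "\<phi> (a - b) = \<phi> a - \<phi> b" "\<phi> (- a) = - \<phi> a"
proof -
  show add: "\<phi> (a + b) = \<phi> a + \<phi> b" and C: "\<phi> (c *\<^sub>C a) = c * \<phi> a" for a b c
    using assms unfolding linear_functional_def by auto
  show "\<phi> (r *\<^sub>R a) = complex_of_real r * \<phi> a"
    using C[of "complex_of_real r" a] by (simp add: scaleC_of_real)
  show "\<phi> 0 = 0" using C[of 0 0] by simp
  show minus: "\<phi> (- a) = - \<phi> a" for a using C[of "-1" a] by (simp add: scaleC_minus_one)
  show "\<phi> (a - b) = \<phi> a - \<phi> b" using add[of a "- b"] minus[of b] by simp
qed

definition bounded_functional :: "('a :: unital_cstar_algebra \<Rightarrow> complex) \<Rightarrow> bool"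
  where "bounded_functional \<phi> \<longleftrightarrow> linear_functional \<phi> \<and> (\<exists>K. \<forall>a. cmod (\<phi> a) \<le> K * norm a)"

lemma bounded_functional_linear: "bounded_functional \<phi> \<Longrightarrow> linear_functional \<phi>"
  by (simp add: bounded_functional_def)

lemma bounded_functional_bounded_linear:
  assumes "bounded_functional \<phi>"
  shows "bounded_linear \<phi>"
proof -
  obtain K where "\<And>a. cmod (\<phi> a) \<le> K * norm a"
    using assms unfolding bounded_functional_def by blast
  then show ?thesis
    using linear_functionalD[OF bounded_functional_linear[OF assms]]
    by (intro bounded_linear_intro[of _ K]) (simp_all add: mult.commute scaleR_conv_of_real)
qed

lemma bounded_functional_continuous:
  assumes "bounded_functional \<phi>" "X \<longlonglongrightarrow> x"
  shows "(\<lambda>n. \<phi> (X n)) \<longlonglongrightarrow> \<phi> x"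
  by (rule bounded_linear.tendsto[OF bounded_functional_bounded_linear[OF assms(1)] assms(2)])

lemma bounded_functional_mult:
  assumes "bounded_functional \<phi>"
  shows "bounded_functional (\<lambda>x. \<phi> (a * x * b))"
proof -
  obtain K where K: "\<And>a. cmod (\<phi> a) \<le> K * norm a"
    using assms unfolding bounded_functional_def by blast
  have "0 \<le> K" using K[of 1] norm_ge_zero[of "\<phi> 1"] by (simp del: norm_ge_zero)
  have "cmod (\<phi> (a * x * b)) \<le> (K * norm a * norm b) * norm x" for x
  proof -
    have "norm (a * x * b) \<le> norm a * norm x * norm b"
      by (metis norm_mult_ineq mult_right_mono norm_ge_zero order_trans)
    then have "K * norm (a * x * b) \<le> K * (norm a * norm x * norm b)"
      using \<open>0 \<le> K\<close> by (rule mult_left_mono)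
    then show ?thesis using K[of "a * x * b"] by (simp add: mult_ac)
  qed
  then show ?thesis
    using linear_functionalD[OF bounded_functional_linear[OF assms]]
    unfolding bounded_functional_def linear_functional_def
    by (auto simp: distrib_left distrib_right mult_scaleC_left mult_scaleC_right)
qed

lemma bounded_functional_mult_left:
  "bounded_functional \<phi> \<Longrightarrow> bounded_functional (\<lambda>x. \<phi> (a * x))"
  using bounded_functional_mult[of \<phi> a 1] by simp

lemma bounded_functional_mult_right:
  "bounded_functional \<phi> \<Longrightarrow> bounded_functional (\<lambda>x. \<phi> (x * b))"
  using bounded_functional_mult[of \<phi> 1 b] by simp

lemma bounded_functional_automorphism:
  assumes "bounded_functional \<phi>" "star_automorphism \<theta>"
  shows "bounded_functional (\<lambda>x. \<phi> (\<theta> x))"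
proof -
  obtain K where K: "\<And>a. cmod (\<phi> a) \<le> K * norm a"
    using assms unfolding bounded_functional_def by blast
  have "0 \<le> K" using K[of 1] norm_ge_zero[of "\<phi> 1"] by (simp del: norm_ge_zero)
  have "cmod (\<phi> (\<theta> x)) \<le> K * norm x" for x
    using K[of "\<theta> x"] mult_left_mono[OF star_automorphism_norm_le[OF assms(2), of x] \<open>0 \<le> K\<close>]
    by linarith
  then show ?thesis
    using linear_functionalD[OF bounded_functional_linear[OF assms(1)]]
      star_automorphismD[OF assms(2)]
    unfolding bounded_functional_def linear_functional_def by auto
qed

lemma cnj_mult_self: "cnj z * z = complex_of_real ((cmod z)\<^sup>2)"
  by (metis complex_norm_square mult.commute of_real_power)

text \<open>
  The optimal choice is \<open>t = 1/B\<close>; for \<open>B = 0\<close> let \<open>t\<close> grow. Here \<open>p\<close> is a squared modulus in the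
  variational proofs of the Cauchy-Schwarz inequality and of the representation theorem.
\<close>

lemma le_mult_of_quadratic_bound:
  fixes p A B :: real
  assumes quad: "\<And>t. 2 * t * p \<le> A + t\<^sup>2 * p * B" and "0 \<le> A" "0 \<le> B"
  shows "p \<le> A * B"
proof (cases "B = 0")
  case True
  have "p \<le> 0"
  proof (rule ccontr)
    assume "\<not> p \<le> 0"
    then show False
      using quad[of "(A + 1) / p"] True \<open>0 \<le> A\<close> by simp
  qed
  with True show ?thesis by simp
next
  case False
  with \<open>0 \<le> B\<close> show ?thesis
    using quad[of "1 / B"] by (simp add: field_simps power2_eq_square)
qed

definition gns_norm :: "('a :: unital_cstar_algebra \<Rightarrow> complex) \<Rightarrow> 'a \<Rightarrow> real"
  where "gns_norm \<omega> a = sqrt (Re (\<omega> (adj a * a)))"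

locale cstar_state =
  fixes \<omega> :: "'a :: unital_cstar_algebra \<Rightarrow> complex"
  assumes state: "state \<omega>"
begin

abbreviation nrm :: "'a \<Rightarrow> real" where "nrm \<equiv> gns_norm \<omega>"

lemma linear: "linear_functional \<omega>"
  using state by (simp add: state_def)

lemmas lin = linear_functionalD[OF linear]

lemma one [simp]: "\<omega> 1 = 1"
  using state by (simp add: state_def)

lemma pos: "0 \<le> Re (\<omega> (adj a * a))" "Im (\<omega> (adj a * a)) = 0"
  using state by (auto simp: state_def complex_nonneg_Reals_iff)

lemma nrm_nonneg [simp]: "0 \<le> nrm a"
  by (simp add: gns_norm_def pos)

lemma nrm_square: "\<omega> (adj a * a) = complex_of_real ((nrm a)\<^sup>2)"
  by (simp add: gns_norm_def pos complex_eq_iff)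

lemma nrm_power2: "(nrm a)\<^sup>2 = Re (\<omega> (adj a * a))"
  by (simp add: gns_norm_def pos)

lemma form_adj: "\<omega> (adj b * a) = cnj (\<omega> (adj a * b))"
proof -
  have "Im (\<omega> (adj (a + c *\<^sub>C b) * (a + c *\<^sub>C b)))
      = Im (c * \<omega> (adj a * b) + cnj c * \<omega> (adj b * a))" for c
    using pos(2)[of a] pos(2)[of b]
    by (simp add: adj_add adj_scaleC distrib_left distrib_right mult_scaleC_left
        mult_scaleC_right scaleC_scaleC lin)
  then have "Im (c * \<omega> (adj a * b) + cnj c * \<omega> (adj b * a)) = 0" for c
    by (simp add: pos)
  from this[of 1] this[of \<i>] show ?thesis by (simp add: complex_eq_iff)
qed

lemma adj: "\<omega> (adj a) = cnj (\<omega> a)"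
  using form_adj[of a 1] by simp

lemma nrm_add_square:
  "(nrm (a + c *\<^sub>C b))\<^sup>2 = (nrm a)\<^sup>2 + 2 * Re (c * \<omega> (adj a * b)) + (cmod c)\<^sup>2 * (nrm b)\<^sup>2"
proof -
  have "Re (cnj c * \<omega> (adj b * a)) = Re (c * \<omega> (adj a * b))"
    unfolding form_adj[of b a] by (metis complex_cnj_mult complex_cnj_cnj cnj.simps(1))
  moreover have "\<omega> (adj (a + c *\<^sub>C b) * (a + c *\<^sub>C b)) = \<omega> (adj a * a) + c * \<omega> (adj a * b)
      + cnj c * \<omega> (adj b * a) + (cnj c * c) * \<omega> (adj b * b)"
    by (simp add: adj_add adj_scaleC distrib_left distrib_right mult_scaleC_left
        mult_scaleC_right scaleC_scaleC lin)
  ultimately show ?thesis by (simp add: nrm_power2 cnj_mult_self del: of_real_power)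
qed

lemma Cauchy_Schwarz: "cmod (\<omega> (adj a * b)) \<le> nrm a * nrm b"
proof -
  define z where "z = \<omega> (adj a * b)"
  have "2 * t * (cmod z)\<^sup>2 \<le> (nrm a)\<^sup>2 + t\<^sup>2 * (cmod z)\<^sup>2 * (nrm b)\<^sup>2" for t
  proof -
    define s where "s = - complex_of_real t * cnj z"
    have "s * z = complex_of_real (- t * (cmod z)\<^sup>2)"
      by (simp add: s_def mult.assoc cnj_mult_self del: of_real_power)
    then have "Re (s * z) = - t * (cmod z)\<^sup>2" by (metis Re_complex_of_real)
    moreover have "(cmod s)\<^sup>2 = t\<^sup>2 * (cmod z)\<^sup>2"
      by (simp add: s_def norm_mult power_mult_distrib)
    moreover have "0 \<le> (nrm a)\<^sup>2 + 2 * Re (s * z) + (cmod s)\<^sup>2 * (nrm b)\<^sup>2"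
      unfolding z_def nrm_add_square[symmetric] by simp
    ultimately show ?thesis by simp
  qed
  then have "(cmod z)\<^sup>2 \<le> (nrm a)\<^sup>2 * (nrm b)\<^sup>2"
    by (rule le_mult_of_quadratic_bound) simp_all
  then have "(cmod z)\<^sup>2 \<le> (nrm a * nrm b)\<^sup>2" by (simp add: power_mult_distrib)
  then show ?thesis unfolding z_def by (rule power2_le_imp_le) simp
qed

lemma nrm_scaleC: "nrm (c *\<^sub>C a) = cmod c * nrm a"
proof -
  have "(nrm (c *\<^sub>C a))\<^sup>2 = (cmod c * nrm a)\<^sup>2"
    using nrm_add_square[of 0 c a] by (simp add: power_mult_distrib gns_norm_def lin)
  then show ?thesis by (simp add: power2_eq_iff_nonneg)
qed

lemma nrm_scaleR: "nrm (r *\<^sub>R a) = \<bar>r\<bar> * nrm a"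
  using nrm_scaleC[of "complex_of_real r" a] by (simp add: scaleC_of_real)

text \<open>
  For \<open>\<parallel>b\<parallel> \<le> 1/2\<close> write \<open>1 - b\<^sup>*b = y\<^sup>2\<close>; then \<open>\<omega>(a\<^sup>*a) - \<omega>(a\<^sup>*b\<^sup>*b a) = \<omega>((y a)\<^sup>*(y a)) \<ge> 0\<close>.
\<close>

lemma nrm_mult: "nrm (b * a) \<le> 2 * norm b * nrm a"
proof -
  have half: "nrm (b * a) \<le> nrm a" if "norm b \<le> 1/2" for b
  proof -
    have "norm (adj b * b) \<le> 1/4"
      using power_mono[OF that, of 2] by (simp add: cstar_identity power2_eq_square)
    moreover have "adj (adj b * b) = adj b * b" by (simp add: adj_mult adj_adj)
    ultimately obtain y where y: "adj y = y" "y * y = 1 - adj b * b"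
      using sqrt_one_minus_exists by blast
    have "adj (y * a) * (y * a) = adj a * (y * y) * a"
      by (simp add: adj_mult y(1) mult.assoc)
    also have "\<dots> = adj a * a - adj (b * a) * (b * a)"
      by (simp add: y(2) algebra_simps adj_mult)
    finally have "(nrm (y * a))\<^sup>2 = (nrm a)\<^sup>2 - (nrm (b * a))\<^sup>2"
      by (simp add: nrm_power2 lin)
    then have "(nrm (b * a))\<^sup>2 \<le> (nrm a)\<^sup>2"
      using zero_le_power2[of "nrm (y * a)"] by linarith
    then show ?thesis by (rule power2_le_imp_le) simp
  qed
  show ?thesis
  proof (cases "b = 0")
    case True
    then show ?thesis by (simp add: gns_norm_def lin)
  next
    case False
    then have "nrm (((1 / (2 * norm b)) *\<^sub>R b) * a) \<le> nrm a"
      by (intro half) simp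
    with False show ?thesis by (simp add: nrm_scaleR field_simps)
  qed
qed

lemma nrm_one [simp]: "nrm 1 = 1"
  by (simp add: gns_norm_def)

lemma nrm_le_norm: "nrm a \<le> 2 * norm a"
  using nrm_mult[of a 1] by simp

lemma bounded: "bounded_functional \<omega>"
proof -
  have "cmod (\<omega> a) \<le> 2 * norm a" for a
    using Cauchy_Schwarz[of 1 a] nrm_le_norm[of a] by simp
  then show ?thesis using linear unfolding bounded_functional_def by blast
qed

end

text \<open>
  The functionals \<open>\<rho>\<close> with \<open>\<bar>\<rho>(a\<^sup>*b)\<bar> \<le> \<parallel>a\<parallel>\<^sub>\<omega> \<parallel>b\<parallel>\<^sub>\<omega>\<close> are those of the form \<open>\<langle>\<Omega>, T \<pi>(\<cdot>)\<Omega>\<rangle>\<close> with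
  \<open>T\<close> a contraction in the commutant of the GNS representation of \<open>\<omega>\<close>.
\<close>

definition dominated_by :: "('a :: unital_cstar_algebra \<Rightarrow> complex) \<Rightarrow> ('a \<Rightarrow> complex) \<Rightarrow> bool"
  where "dominated_by \<omega> \<rho> \<longleftrightarrow>
    linear_functional \<rho> \<and> (\<forall>a b. cmod (\<rho> (adj a * b)) \<le> gns_norm \<omega> a * gns_norm \<omega> b)"

context cstar_state
begin

lemma dominated_le: "dominated_by \<omega> \<rho> \<Longrightarrow> cmod (\<rho> (adj a * b)) \<le> nrm a * nrm b"
  by (simp add: dominated_by_def)

lemma dominated_le_nrm: "dominated_by \<omega> \<rho> \<Longrightarrow> cmod (\<rho> a) \<le> nrm a"
  using dominated_le[of \<rho> 1 a] by simp

lemma dominated_linear: "dominated_by \<omega> \<rho> \<Longrightarrow> linear_functional \<rho>"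
  by (simp add: dominated_by_def)

lemma dominated_bounded:
  assumes "dominated_by \<omega> \<rho>"
  shows "bounded_functional \<rho>"
proof -
  have "cmod (\<rho> a) \<le> 2 * norm a" for a
    using dominated_le_nrm[OF assms, of a] nrm_le_norm[of a] by simp
  then show ?thesis
    using dominated_linear[OF assms] unfolding bounded_functional_def by blast
qed

end

section \<open>Approximation of functionals by vectors\<close>

text \<open>
  In the GNS representation \<open>approximates \<omega> c \<rho>\<close> says that the vectors \<open>\<pi>(c n)\<Omega>\<close> converge in
  norm to the vector that represents \<open>\<rho>\<close>. Stating it with a uniform error avoids the
  completion of the algebra.
\<close>

definition approximates ::
    "('a :: unital_cstar_algebra \<Rightarrow> complex) \<Rightarrow> (nat \<Rightarrow> 'a) \<Rightarrow> ('a \<Rightarrow> complex) \<Rightarrow> bool"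
  where "approximates \<omega> c \<rho> \<longleftrightarrow>
    (\<exists>\<epsilon>. \<epsilon> \<longlonglongrightarrow> 0 \<and> (\<forall>n x. cmod (\<omega> (adj (c n) * x) - \<rho> x) \<le> \<epsilon> n * gns_norm \<omega> x))"

context cstar_state
begin

text \<open>
  This is the Riesz representation theorem. An element \<open>c\<close> that minimises
  \<open>\<parallel>c\<parallel>\<^sub>\<omega>\<^sup>2 - 2 Re \<rho>(c)\<close> up to \<open>\<epsilon>\<^sup>2\<close> satisfies the Euler equation \<open>\<omega>(c\<^sup>*x) = \<rho>(x)\<close> up to
  \<open>\<epsilon> \<parallel>x\<parallel>\<^sub>\<omega>\<close>.
\<close>

lemma approximation_step:
  assumes \<rho>: "dominated_by \<omega> \<rho>" and e: "0 < e"
  obtains c where "\<And>x. cmod (\<omega> (adj c * x) - \<rho> x) \<le> e * nrm x"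
proof -
  note lin\<rho> = linear_functionalD[OF dominated_linear[OF \<rho>]]
  define I where "I c = (nrm c)\<^sup>2 - 2 * Re (\<rho> c)" for c
  have "-1 \<le> I c" for c
  proof -
    have "Re (\<rho> c) \<le> nrm c"
      using dominated_le_nrm[OF \<rho>, of c] complex_Re_le_cmod[of "\<rho> c"] by linarith
    moreover have "0 \<le> (nrm c - 1)\<^sup>2" by simp
    ultimately show ?thesis by (simp add: I_def power2_diff)
  qed
  then have bdd: "bdd_below (range I)" by (intro bdd_belowI) auto
  obtain c where c: "I c < Inf (range I) + e\<^sup>2"
    using cInf_lessD[of "range I" "Inf (range I) + e\<^sup>2"] e by auto
  have c_min: "I c - e\<^sup>2 \<le> I x" for x
    using cInf_lower[OF _ bdd, of "I x"] c by auto
  show ?thesis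
  proof (rule that[of c])
    fix x
    define d where "d = \<omega> (adj c * x) - \<rho> x"
    have "2 * t * (cmod d)\<^sup>2 \<le> e\<^sup>2 + t\<^sup>2 * (cmod d)\<^sup>2 * (nrm x)\<^sup>2" for t
    proof -
      define s where "s = - complex_of_real t * cnj d"
      have "s * d = complex_of_real (- t * (cmod d)\<^sup>2)"
        by (simp add: s_def mult.assoc cnj_mult_self del: of_real_power)
      then have "Re (s * d) = - t * (cmod d)\<^sup>2" by (metis Re_complex_of_real)
      moreover have "(cmod s)\<^sup>2 = t\<^sup>2 * (cmod d)\<^sup>2"
        by (simp add: s_def norm_mult power_mult_distrib)
      moreover have "I (c + s *\<^sub>C x) = I c + 2 * Re (s * d) + (cmod s)\<^sup>2 * (nrm x)\<^sup>2"
        by (simp add: I_def nrm_add_square lin\<rho> d_def right_diff_distrib)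
      ultimately show ?thesis
        using c_min[of "c + s *\<^sub>C x"] by simp
    qed
    then have "(cmod d)\<^sup>2 \<le> e\<^sup>2 * (nrm x)\<^sup>2"
      by (rule le_mult_of_quadratic_bound) simp_all
    then have "(cmod d)\<^sup>2 \<le> (e * nrm x)\<^sup>2" by (simp add: power_mult_distrib)
    then have "cmod d \<le> e * nrm x" by (rule power2_le_imp_le) (use e in simp)
    then show "cmod (\<omega> (adj c * x) - \<rho> x) \<le> e * nrm x" by (simp add: d_def)
  qed
qed

lemma approximation_exists:
  assumes "dominated_by \<omega> \<rho>"
  obtains c where "approximates \<omega> c \<rho>"
proof -
  have "\<exists>c. \<forall>x. cmod (\<omega> (adj c * x) - \<rho> x) \<le> (1 / real (Suc n)) * nrm x" for n
    using approximation_step[OF assms, of "1 / real (Suc n)"] by (metis of_nat_0_less_iff zero_less_Suc zero_less_divide_1_iff)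
  then obtain c where c: "\<And>n x. cmod (\<omega> (adj (c n) * x) - \<rho> x) \<le> (1 / real (Suc n)) * nrm x"
    by metis
  have "(\<lambda>n. 1 / real (Suc n)) \<longlonglongrightarrow> 0"
    using LIMSEQ_inverse_real_of_nat by (simp add: divide_inverse)
  then show ?thesis
    using c by (intro that[of c]) (auto simp: approximates_def)
qed

end

section \<open>Entire functions and analytic elements\<close>

lemma entire_holomorphic:
  assumes f: "entire f" and \<phi>: "bounded_functional \<phi>"
  shows "(\<lambda>z. \<phi> (f z)) holomorphic_on UNIV"
  unfolding holomorphic_on_def
proof safe
  fix z
  obtain d where "(f has_derivative (\<lambda>h. h *\<^sub>C d)) (at z)"
    using f unfolding entire_def by blast
  then have "((\<lambda>z. \<phi> (f z)) has_derivative (\<lambda>h. \<phi> (h *\<^sub>C d))) (at z)"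
    by (rule bounded_linear.has_derivative[OF bounded_functional_bounded_linear[OF \<phi>]])
  moreover have "(\<lambda>h. \<phi> (h *\<^sub>C d)) = (*) (\<phi> d)"
    by (simp add: fun_eq_iff linear_functionalD[OF bounded_functional_linear[OF \<phi>]])
  ultimately have "((\<lambda>z. \<phi> (f z)) has_field_derivative \<phi> d) (at z)"
    by (simp add: has_field_derivative_def)
  then show "(\<lambda>z. \<phi> (f z)) field_differentiable (at z)"
    by (auto simp: field_differentiable_def)
qed

lemma zero_islimpt_Reals: "(0 :: complex) islimpt \<real>"
  unfolding islimpt_approachable
proof safe
  fix e :: real assume "0 < e"
  then show "\<exists>x'\<in>\<real>. x' \<noteq> (0 :: complex) \<and> dist x' 0 < e"
    by (intro bexI[of _ "complex_of_real (e / 2)"]) (auto simp: dist_norm norm_divide)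
qed

lemma holomorphic_eq_if_eq_on_reals:
  assumes "g holomorphic_on UNIV" "h holomorphic_on UNIV"
    and "\<And>t. g (complex_of_real t) = h (complex_of_real t)"
  shows "g z = h z"
proof -
  have "g z - h z = 0"
    using assms(1,2)
    by (intro analytic_continuation[of "\<lambda>z. g z - h z" UNIV \<real> 0 z] holomorphic_intros)
      (auto simp: zero_islimpt_Reals assms(3) elim!: Reals_cases)
  then show ?thesis by simp
qed

lemma entire_const: "entire (\<lambda>z. a)"
  unfolding entire_def by (rule allI, rule exI[of _ 0]) (simp add: scaleC.zero_right)

lemma entire_mult:
  assumes "entire f" "entire g"
  shows "entire (\<lambda>z. f z * g z)"
  unfolding entire_def
proof
  fix z
  obtain d e where "(f has_derivative (\<lambda>h. h *\<^sub>C d)) (at z)" "(g has_derivative (\<lambda>h. h *\<^sub>C e)) (at z)"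
    using assms unfolding entire_def by blast
  from has_derivative_mult[OF this]
  show "\<exists>d. ((\<lambda>z. f z * g z) has_derivative (\<lambda>h. h *\<^sub>C d)) (at z)"
    by (intro exI[of _ "f z * e + d * g z"])
      (simp add: mult_scaleC_left mult_scaleC_right scaleC_add_right)
qed

lemma entire_adj:
  assumes "entire f"
  shows "entire (\<lambda>z. adj (f (cnj z)))"
  unfolding entire_def
proof
  fix z
  obtain d where d: "(f has_derivative (\<lambda>h. h *\<^sub>C d)) (at (cnj z))"
    using assms unfolding entire_def by blast
  have "(cnj has_derivative cnj) (at z)"
    by (rule bounded_linear_imp_has_derivative[OF bounded_linear_cnj])
  from bounded_linear.has_derivative[OF bounded_linear_adj has_derivative_compose[OF this d]]
  show "\<exists>d. ((\<lambda>z. adj (f (cnj z))) has_derivative (\<lambda>h. h *\<^sub>C d)) (at z)"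
    by (intro exI[of _ "adj d"]) (simp add: adj_scaleC)
qed

lemma entire_automorphism:
  assumes "entire f" and \<theta>: "star_automorphism \<theta>"
  shows "entire (\<lambda>z. \<theta> (f z))"
  unfolding entire_def
proof
  fix z
  obtain d where d: "(f has_derivative (\<lambda>h. h *\<^sub>C d)) (at z)"
    using assms unfolding entire_def by blast
  from bounded_linear.has_derivative[OF star_automorphism_bounded_linear[OF \<theta>] d]
  show "\<exists>d. ((\<lambda>z. \<theta> (f z)) has_derivative (\<lambda>h. h *\<^sub>C d)) (at z)"
    by (intro exI[of _ "\<theta> d"]) (simp add: star_automorphismD[OF \<theta>])
qed

lemma entire_affine:
  assumes "entire f"
  shows "entire (\<lambda>z. f (c * z + w))"
  unfolding entire_def
proof
  fix z
  obtain d where d: "(f has_derivative (\<lambda>h. h *\<^sub>C d)) (at (c * z + w))"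
    using assms unfolding entire_def by blast
  have "((\<lambda>z. c * z + w) has_derivative (\<lambda>h. c * h)) (at z)"
    by (auto intro!: derivative_eq_intros)
  from has_derivative_compose[OF this d]
  show "\<exists>d. ((\<lambda>z. f (c * z + w)) has_derivative (\<lambda>h. h *\<^sub>C d)) (at z)"
    by (intro exI[of _ "c *\<^sub>C d"]) (simp add: scaleC_scaleC mult.commute)
qed

lemma entire_scaleR:
  assumes "entire f"
  shows "entire (\<lambda>z. r *\<^sub>R f z)"
  unfolding entire_def
proof
  fix z
  obtain d where d: "(f has_derivative (\<lambda>h. h *\<^sub>C d)) (at z)"
    using assms unfolding entire_def by blast
  from has_derivative_scaleR_right[OF d, of r]
  show "\<exists>d. ((\<lambda>z. r *\<^sub>R f z) has_derivative (\<lambda>h. h *\<^sub>C d)) (at z)"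
    by (intro exI[of _ "r *\<^sub>R d"]) (simp add: scaleC.scaleR_right)
qed

locale cstar_action =
  fixes \<alpha> :: "real \<Rightarrow> 'a :: unital_cstar_algebra \<Rightarrow> 'a"
  assumes action: "strongly_continuous_action \<alpha>"
begin

lemma automorphism: "star_automorphism (\<alpha> t)"
  using action by (simp add: strongly_continuous_action_def)

lemmas \<alpha>_simps = star_automorphismD[OF automorphism]

lemma norm_\<alpha>_le: "norm (\<alpha> t a) \<le> norm a"
  by (rule star_automorphism_norm_le[OF automorphism])

lemma \<alpha>_zero [simp]: "\<alpha> 0 a = a"
  using action by (simp add: strongly_continuous_action_def)

lemma \<alpha>_add: "\<alpha> (s + t) a = \<alpha> s (\<alpha> t a)"
  using action by (simp add: strongly_continuous_action_def)

lemma continuous: "continuous_on UNIV (\<lambda>t. \<alpha> t a)"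
  using action by (simp add: strongly_continuous_action_def)

lemma extension_mem: "analytic_extension \<alpha> a f \<Longrightarrow> a \<in> entire_elements \<alpha>"
  unfolding entire_elements_def by blast

lemma extension_complex_time:
  assumes "a \<in> entire_elements \<alpha>"
  shows "analytic_extension \<alpha> a (\<lambda>z. complex_time \<alpha> z a)"
proof -
  have "\<exists>f. analytic_extension \<alpha> a f" using assms by (simp add: entire_elements_def)
  then have "analytic_extension \<alpha> a (SOME f. analytic_extension \<alpha> a f)" by (rule someI_ex)
  then show ?thesis by (simp add: complex_time_def[abs_def])
qed

text \<open>
  The scalar identity theorem applies after composition with a bounded functional. Since
  \<open>\<alpha>\<^sub>z(a)\<close> only ever occurs under a bounded functional, this form of uniqueness is enough.
\<close>

lemma extension_unique:
  assumes "analytic_extension \<alpha> a f" "analytic_extension \<alpha> a g" "bounded_functional \<phi>"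
  shows "\<phi> (f z) = \<phi> (g z)"
proof (rule holomorphic_eq_if_eq_on_reals[of "\<lambda>z. \<phi> (f z)" "\<lambda>z. \<phi> (g z)"])
  show "(\<lambda>z. \<phi> (f z)) holomorphic_on UNIV" "(\<lambda>z. \<phi> (g z)) holomorphic_on UNIV"
    using assms by (simp_all add: analytic_extension_def entire_holomorphic)
  show "\<phi> (f (complex_of_real t)) = \<phi> (g (complex_of_real t))" for t
    using assms by (simp add: analytic_extension_def)
qed

lemma complex_time_eq:
  assumes "analytic_extension \<alpha> a f" "bounded_functional \<phi>"
  shows "\<phi> (complex_time \<alpha> z a) = \<phi> (f z)"
  by (rule extension_unique[OF extension_complex_time[OF extension_mem[OF assms(1)]] assms])

lemma extension_mult:
  assumes "analytic_extension \<alpha> a f" "analytic_extension \<alpha> b g"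
  shows "analytic_extension \<alpha> (a * b) (\<lambda>z. f z * g z)"
  using assms unfolding analytic_extension_def by (auto simp: entire_mult \<alpha>_simps)

lemma extension_adj:
  assumes "analytic_extension \<alpha> a f"
  shows "analytic_extension \<alpha> (adj a) (\<lambda>z. adj (f (cnj z)))"
  using assms unfolding analytic_extension_def by (auto simp: entire_adj \<alpha>_simps)

lemma extension_automorphism:
  assumes "analytic_extension \<alpha> a f" "star_automorphism \<theta>" "\<And>t a. \<alpha> t (\<theta> a) = \<theta> (\<alpha> t a)"
  shows "analytic_extension \<alpha> (\<theta> a) (\<lambda>z. \<theta> (f z))"
  using assms(1) entire_automorphism[OF _ assms(2), of f]
  unfolding analytic_extension_def by (auto simp: assms(3))

lemma extension_action:
  assumes "analytic_extension \<alpha> a f"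
  shows "analytic_extension \<alpha> (\<alpha> t a) (\<lambda>z. \<alpha> t (f z))"
proof (rule extension_automorphism[OF assms automorphism])
  show "\<alpha> s (\<alpha> t a) = \<alpha> t (\<alpha> s a)" for s a
    using \<alpha>_add[of s t a] \<alpha>_add[of t s a] by (simp add: add.commute)
qed

lemma extension_shift:
  assumes "analytic_extension \<alpha> a f"
  shows "analytic_extension \<alpha> (\<alpha> t a) (\<lambda>z. f (z + complex_of_real t))"
proof -
  have f: "entire f" "\<And>t. f (complex_of_real t) = \<alpha> t a"
    using assms by (simp_all add: analytic_extension_def)
  have "entire (\<lambda>z. f (z + complex_of_real t))"
    using entire_affine[OF f(1), of 1 "complex_of_real t"] by simp
  moreover have "f (complex_of_real s + complex_of_real t) = \<alpha> s (\<alpha> t a)" for s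
    using f(2)[of "s + t"] by (simp add: \<alpha>_add)
  ultimately show ?thesis by (simp add: analytic_extension_def)
qed

lemma extension_const: "analytic_extension \<alpha> 1 (\<lambda>z. 1)"
  by (simp add: analytic_extension_def entire_const \<alpha>_simps)

end

section \<open>Gaussian averages\<close>

lemma exp_minus_abs_integrable: "(\<lambda>t :: real. exp (- \<bar>t\<bar>)) integrable_on UNIV"
proof -
  have "(\<lambda>t :: real. exp (-1 * t)) integrable_on {0..}"
    by (rule integrable_on_exp_minus_to_infinity) simp
  then have R: "(\<lambda>t :: real. exp (- \<bar>t\<bar>)) integrable_on {0..}"
    by (rule integrable_eq) simp
  then have "(\<lambda>t :: real. exp (- \<bar>t\<bar>)) absolutely_integrable_on {0..}"
    by (intro nonnegative_absolutely_integrable_1) simp_all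
  then have "(\<lambda>t :: real. exp (- \<bar>- t\<bar>)) absolutely_integrable_on {..0}"
    using has_absolute_integral_reflect_real[of "{..0}" "{0..}" "\<lambda>t. exp (- \<bar>t\<bar>)"] by auto
  then have L: "(\<lambda>t :: real. exp (- \<bar>t\<bar>)) integrable_on {..0}"
    by (simp add: absolutely_integrable_on_def)
  have "{..0} \<union> {0..} = (UNIV :: real set)" "{..0} \<inter> {0..} = {0 :: real}" by auto
  then show ?thesis using integrable_Un[OF _ L R] by simp
qed

text \<open>
  All the integrands below are dominated by a multiple of \<open>exp (- \<bar>t\<bar>)\<close>.
\<close>

lemma exp_dominated_integrable:
  fixes f :: "real \<Rightarrow> 'b :: banach"
  assumes "continuous_on UNIV f" "\<And>t. norm (f t) \<le> K * exp (- \<bar>t\<bar>)"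
  shows "f integrable_on UNIV"
    and "norm (integral UNIV f) \<le> K * integral UNIV (\<lambda>t. exp (- \<bar>t\<bar>))"
proof -
  have g: "(\<lambda>t. K * exp (- \<bar>t\<bar>)) integrable_on UNIV"
    using integrable_on_mult_right[OF exp_minus_abs_integrable] .
  show f: "f integrable_on UNIV"
  proof (rule integrable_on_all_intervals_UNIV[OF _ assms(2) g])
    show "f integrable_on cbox a b" for a b
      by (rule integrable_continuous) (rule continuous_on_subset[OF assms(1) subset_UNIV])
  qed
  show "norm (integral UNIV f) \<le> K * integral UNIV (\<lambda>t. exp (- \<bar>t\<bar>))"
    using integral_norm_bound_integral[OF f g] assms by simp
qed

lemma integral_UNIV_translate:
  fixes f :: "real \<Rightarrow> 'b :: banach"
  assumes "f integrable_on UNIV"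
  shows "integral UNIV (\<lambda>t. f (t + s)) = integral UNIV f"
proof (rule integral_unique)
  show "((\<lambda>t. f (t + s)) has_integral integral UNIV f) UNIV"
    unfolding has_integral'[of "\<lambda>t. f (t + s)" _ UNIV]
  proof (intro allI impI)
    fix e :: real assume "0 < e"
    have "(f has_integral integral UNIV f) UNIV" using assms by (rule integrable_integral)
    then have "\<exists>B>0. \<forall>a b. ball 0 B \<subseteq> cbox a b \<longrightarrow>
        (\<exists>z. (f has_integral z) (cbox a b) \<and> norm (z - integral UNIV f) < e)"
      using \<open>0 < e\<close> unfolding has_integral'[of f _ UNIV] by (simp only: UNIV_I if_True)
    then obtain B where B: "B > 0" "\<And>a b. ball 0 B \<subseteq> cbox a b \<Longrightarrow>
        \<exists>z. (f has_integral z) (cbox a b) \<and> norm (z - integral UNIV f) < e"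
      by blast
    show "\<exists>B>0. \<forall>a b. ball 0 B \<subseteq> cbox a b \<longrightarrow>
        (\<exists>z. ((\<lambda>x. if x \<in> UNIV then f (x + s) else 0) has_integral z) (cbox a b) \<and>
          norm (z - integral UNIV f) < e)"
    proof (intro exI[of _ "B + \<bar>s\<bar>"] conjI allI impI)
      show "0 < B + \<bar>s\<bar>" using B by simp
      fix a b :: real assume ab: "ball 0 (B + \<bar>s\<bar>) \<subseteq> cbox a b"
      have "ball 0 B \<subseteq> cbox (a + s) (b + s)"
      proof
        fix x :: real assume "x \<in> ball 0 B"
        then have "x - s \<in> ball 0 (B + \<bar>s\<bar>)" by (auto simp: dist_real_def)
        then have "x - s \<in> cbox a b" using ab by blast
        then show "x \<in> cbox (a + s) (b + s)" by auto
      qed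
      then obtain z where z: "(f has_integral z) (cbox (a + s) (b + s))"
          "norm (z - integral UNIV f) < e"
        using B(2) by blast
      then have "((f \<circ> (+) s) has_integral z) (cbox a b)"
        using has_integral_shift_cbox_iff[of f s z a b] by simp
      with z(2) show "\<exists>z. ((\<lambda>x. if x \<in> UNIV then f (x + s) else 0) has_integral z) (cbox a b) \<and>
          norm (z - integral UNIV f) < e"
        by (auto simp: o_def add.commute)
    qed
  qed
qed

definition gauss :: "complex \<Rightarrow> real \<Rightarrow> complex"
  where "gauss z t = exp (- (complex_of_real t - z)\<^sup>2)"

definition gauss_bound :: "complex \<Rightarrow> real"
  where "gauss_bound z = exp (2 * (Im z)\<^sup>2 + 9 + cmod z)"

text \<open>
  With \<open>w = t - z\<close> the modulus of the kernel is \<open>exp (2 (Im z)\<^sup>2 - \<bar>w\<bar>\<^sup>2)\<close>, and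
  \<open>4 \<bar>w\<bar> - \<bar>w\<bar>\<^sup>2 \<le> 25/4 - \<bar>w\<bar>\<close>. The factor \<open>exp (4 \<bar>w\<bar> + 2)\<close> leaves room for the
  remainder terms of the \<open>z\<close>-derivative. The number \<open>9\<close> in the bound is \<open>2\<close> plus \<open>25/4\<close> rounded up.
\<close>

lemma gauss_decay:
  "cmod (gauss z t) * exp (4 * cmod (complex_of_real t - z) + 2) \<le> gauss_bound z * exp (- \<bar>t\<bar>)"
proof -
  define w where "w = complex_of_real t - z"
  have "cmod w ^ 2 = (Re w)\<^sup>2 + (Im w)\<^sup>2" by (rule cmod_power2)
  moreover have "(Im w)\<^sup>2 = (Im z)\<^sup>2" by (simp add: w_def)
  ultimately have "Re (w\<^sup>2) = (cmod w)\<^sup>2 - 2 * (Im z)\<^sup>2"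
    by (simp add: power2_eq_square)
  then have "cmod (gauss z t) = exp (2 * (Im z)\<^sup>2 - (cmod w)\<^sup>2)"
    by (simp add: gauss_def w_def)
  then have eq: "cmod (gauss z t) * exp (4 * cmod w + 2)
      = exp (2 * (Im z)\<^sup>2 - (cmod w)\<^sup>2 + (4 * cmod w + 2))"
    by (simp only: exp_add)
  have "4 * cmod w - (cmod w)\<^sup>2 \<le> 7 - cmod w"
    using zero_le_power2[of "cmod w - 5/2"] by (simp add: power2_diff) (simp add: power2_eq_square)
  moreover have "\<bar>t\<bar> \<le> cmod w + cmod z"
    using norm_triangle_ineq[of w z] by (simp add: w_def)
  ultimately have "2 * (Im z)\<^sup>2 - (cmod w)\<^sup>2 + (4 * cmod w + 2)
      \<le> (2 * (Im z)\<^sup>2 + 9 + cmod z) + - \<bar>t\<bar>" by linarith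
  then show ?thesis
    unfolding w_def[symmetric] eq gauss_bound_def exp_add[symmetric] by simp
qed

lemma gauss_le: "cmod (gauss z t) \<le> gauss_bound z * exp (- \<bar>t\<bar>)"
proof -
  have "cmod (gauss z t) * 1 \<le> cmod (gauss z t) * exp (4 * cmod (complex_of_real t - z) + 2)"
    by (intro mult_left_mono) auto
  then show ?thesis using gauss_decay[of z t] by simp
qed

lemma continuous_gauss: "continuous_on UNIV (gauss z)"
  unfolding gauss_def[abs_def] by (intro continuous_intros)

lemma gauss_translate: "gauss (z + complex_of_real s) (t + s) = gauss z t"
  by (simp add: gauss_def)

text \<open>
  With \<open>v = 2 h w - h\<^sup>2\<close> the quotient \<open>gauss (z + h) t / gauss z t\<close> is \<open>exp v\<close>, so the remainder is that
  of the second-order Taylor estimate for \<open>exp\<close>, up to the term \<open>h\<^sup>2\<close>.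
\<close>

lemma gauss_remainder:
  assumes h: "cmod h \<le> 1"
  shows "cmod (gauss (z + h) t - gauss z t - h * (2 * (complex_of_real t - z) * gauss z t))
    \<le> (cmod h)\<^sup>2 * 3 * (gauss_bound z * exp (- \<bar>t\<bar>))"
proof -
  define w where "w = complex_of_real t - z"
  define v where "v = 2 * h * w - h\<^sup>2"
  define x where "x = 2 * cmod w + 1"
  have "gauss (z + h) t = gauss z t * exp v"
    by (simp add: gauss_def v_def w_def exp_add[symmetric] power2_eq_square algebra_simps)
  then have split: "gauss (z + h) t - gauss z t - h * (2 * w * gauss z t)
      = gauss z t * ((exp v - 1 - v) - h\<^sup>2)"
    by (simp add: v_def algebra_simps)
  have "cmod v \<le> 2 * cmod h * cmod w + cmod h * cmod h"
    using norm_triangle_ineq4[of "2 * h * w" "h\<^sup>2"]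
    by (simp add: v_def norm_mult norm_power power2_eq_square)
  also have "\<dots> \<le> 2 * cmod h * cmod w + cmod h * 1"
    using h by (intro add_left_mono mult_left_mono) auto
  finally have v: "cmod v \<le> cmod h * x" by (simp add: x_def algebra_simps)
  also have "\<dots> \<le> 1 * x" using h by (intro mult_right_mono) (auto simp: x_def)
  finally have vx: "cmod v \<le> x" by simp
  have "x\<^sup>2 / 2 \<le> exp x"
  proof -
    have "0 \<le> x" by (simp add: x_def)
    then show ?thesis using exp_lower_Taylor_quadratic[of x] by simp
  qed
  have "cmod (exp v - 1 - v) \<le> exp (cmod v) * (cmod v)\<^sup>2"
    using Taylor_exp_field[of v 1] by (simp add: power2_eq_square algebra_simps)
  also have "\<dots> \<le> exp x * (cmod h * x)\<^sup>2"
    using v vx by (intro mult_mono power_mono) auto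
  also have "\<dots> = (cmod h)\<^sup>2 * (exp x * x\<^sup>2)" by (simp add: power_mult_distrib)
  also have "\<dots> \<le> (cmod h)\<^sup>2 * (exp x * (2 * exp x))"
    using \<open>x\<^sup>2 / 2 \<le> exp x\<close> by (intro mult_left_mono) auto
  also have "exp x * (2 * exp x) = 2 * exp (4 * cmod w + 2)"
    by (simp add: x_def exp_add[symmetric])
  finally have "cmod (exp v - 1 - v) \<le> (cmod h)\<^sup>2 * (2 * exp (4 * cmod w + 2))" .
  moreover have "(cmod h)\<^sup>2 * 1 \<le> (cmod h)\<^sup>2 * exp (4 * cmod w + 2)"
    by (intro mult_left_mono) auto
  ultimately have "cmod ((exp v - 1 - v) - h\<^sup>2) \<le> (cmod h)\<^sup>2 * 3 * exp (4 * cmod w + 2)"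
    using norm_triangle_ineq4[of "exp v - 1 - v" "h\<^sup>2"] by (simp add: norm_power)
  then have "cmod (gauss z t) * cmod ((exp v - 1 - v) - h\<^sup>2)
      \<le> cmod (gauss z t) * ((cmod h)\<^sup>2 * 3 * exp (4 * cmod w + 2))"
    by (rule mult_left_mono) simp
  also have "\<dots> = (cmod h)\<^sup>2 * 3 * (cmod (gauss z t) * exp (4 * cmod w + 2))" by simp
  also have "\<dots> \<le> (cmod h)\<^sup>2 * 3 * (gauss_bound z * exp (- \<bar>t\<bar>))"
    unfolding w_def by (intro mult_left_mono gauss_decay) auto
  finally show ?thesis
    unfolding w_def[symmetric] split by (simp add: norm_mult)
qed

definition gauss_average :: "(real \<Rightarrow> 'a :: unital_cstar_algebra) \<Rightarrow> complex \<Rightarrow> 'a"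
  where "gauss_average u z = integral UNIV (\<lambda>t. gauss z t *\<^sub>C u t)"

locale bounded_path =
  fixes u :: "real \<Rightarrow> 'a :: unital_cstar_algebra" and M :: real
  assumes cont: "continuous_on UNIV u" and bound: "\<And>t. norm (u t) \<le> M"
begin

lemma integrable_kernel:
  assumes "continuous_on UNIV k" "\<And>t. cmod (k t) \<le> K * exp (- \<bar>t\<bar>)"
  shows "(\<lambda>t. k t *\<^sub>C u t) integrable_on UNIV"
    and "norm (integral UNIV (\<lambda>t. k t *\<^sub>C u t)) \<le> K * M * integral UNIV (\<lambda>t. exp (- \<bar>t\<bar>))"
proof -
  have c: "continuous_on UNIV (\<lambda>t. k t *\<^sub>C u t)"
    by (intro scaleC.continuous_on assms cont)
  have b: "norm (k t *\<^sub>C u t) \<le> K * M * exp (- \<bar>t\<bar>)" for t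
    using mult_mono[OF assms(2)[of t] bound[of t] order_trans[OF norm_ge_zero assms(2)]]
    by (simp add: norm_scaleC mult_ac)
  show "(\<lambda>t. k t *\<^sub>C u t) integrable_on UNIV"
    and "norm (integral UNIV (\<lambda>t. k t *\<^sub>C u t)) \<le> K * M * integral UNIV (\<lambda>t. exp (- \<bar>t\<bar>))"
    using exp_dominated_integrable[OF c b] by auto
qed

lemma integrable_gauss: "(\<lambda>t. gauss z t *\<^sub>C u t) integrable_on UNIV"
  by (rule integrable_kernel[OF continuous_gauss gauss_le])

lemma gauss_average_translate:
  "gauss_average u (z + complex_of_real s) = gauss_average (\<lambda>t. u (t + s)) z"
  using integral_UNIV_translate[OF integrable_gauss[of "z + complex_of_real s"], of s]
  by (simp add: gauss_average_def gauss_translate)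

lemma gauss_average_automorphism:
  assumes "star_automorphism \<theta>"
  shows "gauss_average (\<lambda>t. \<theta> (u t)) z = \<theta> (gauss_average u z)"
  using integral_linear[OF integrable_gauss star_automorphism_bounded_linear[OF assms], of z]
  by (simp add: gauss_average_def o_def star_automorphismD[OF assms])

lemma functional_gauss_average:
  assumes "bounded_functional \<phi>"
  shows "((\<lambda>t. gauss z t * \<phi> (u t)) has_integral \<phi> (gauss_average u z)) UNIV"
  using has_integral_linear[OF integrable_integral[OF integrable_gauss]
      bounded_functional_bounded_linear[OF assms], of z]
  by (simp add: gauss_average_def o_def
      linear_functionalD[OF bounded_functional_linear[OF assms]])

lemma entire_gauss_average: "entire (gauss_average u)"
  unfolding entire_def
proof
  fix z
  define k where "k t = 2 * (complex_of_real t - z) * gauss z t" for t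
  have k_cont: "continuous_on UNIV k"
    unfolding k_def[abs_def] gauss_def by (intro continuous_intros)
  have k_le: "cmod (k t) \<le> gauss_bound z * exp (- \<bar>t\<bar>)" for t
  proof -
    define r where "r = cmod (complex_of_real t - z)"
    have "2 * r \<le> exp (4 * r + 2)"
      using exp_ge_add_one_self[of "4 * r + 2"] norm_ge_zero[of "complex_of_real t - z"]
      unfolding r_def by linarith
    then have "cmod (gauss z t) * (2 * r) \<le> cmod (gauss z t) * exp (4 * r + 2)"
      by (rule mult_left_mono) simp
    moreover have "cmod (k t) = cmod (gauss z t) * (2 * r)"
      unfolding k_def norm_mult r_def by simp
    ultimately show ?thesis
      using gauss_decay[of z t] unfolding r_def by linarith
  qed
  define d where "d = integral UNIV (\<lambda>t. k t *\<^sub>C u t)"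
  define C where "C = 3 * gauss_bound z * M * integral UNIV (\<lambda>t. exp (- \<bar>t\<bar>))"
  have quad: "norm (gauss_average u (z + h) - gauss_average u z - h *\<^sub>C d) \<le> C * (cmod h)\<^sup>2"
    if h: "cmod h \<le> 1" for h
  proof -
    define R where "R t = gauss (z + h) t - gauss z t - h * k t" for t
    have hk: "(\<lambda>t. h *\<^sub>C k t *\<^sub>C u t) integrable_on UNIV"
        "integral UNIV (\<lambda>t. h *\<^sub>C k t *\<^sub>C u t) = h *\<^sub>C d"
      using integrable_linear[OF integrable_kernel(1)[OF k_cont k_le] scaleC.bounded_linear_right[of h]]
        integral_linear[OF integrable_kernel(1)[OF k_cont k_le] scaleC.bounded_linear_right[of h]]
      by (simp_all add: o_def d_def)
    have "integral UNIV (\<lambda>t. R t *\<^sub>C u t)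
        = integral UNIV (\<lambda>t. gauss (z + h) t *\<^sub>C u t - gauss z t *\<^sub>C u t - h *\<^sub>C k t *\<^sub>C u t)"
      by (simp add: R_def scaleC.diff_left scaleC_scaleC)
    also have "\<dots> = gauss_average u (z + h) - gauss_average u z - h *\<^sub>C d"
      by (simp add: integral_diff integrable_diff integrable_gauss hk gauss_average_def)
    finally have eq: "gauss_average u (z + h) - gauss_average u z - h *\<^sub>C d
        = integral UNIV (\<lambda>t. R t *\<^sub>C u t)" by simp
    have "continuous_on UNIV R"
      unfolding R_def[abs_def] by (intro continuous_intros continuous_gauss k_cont)
    moreover have "cmod (R t) \<le> ((cmod h)\<^sup>2 * 3 * gauss_bound z) * exp (- \<bar>t\<bar>)" for t
      using gauss_remainder[OF h, of z t] by (simp add: R_def k_def mult_ac)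
    ultimately have "norm (integral UNIV (\<lambda>t. R t *\<^sub>C u t))
        \<le> ((cmod h)\<^sup>2 * 3 * gauss_bound z) * M * integral UNIV (\<lambda>t. exp (- \<bar>t\<bar>))"
      by (rule integrable_kernel(2))
    then show ?thesis unfolding eq by (simp add: C_def mult_ac)
  qed
  have "(gauss_average u has_derivative (\<lambda>h. h *\<^sub>C d)) (at z)"
    unfolding has_derivative_at
  proof
    show "bounded_linear (\<lambda>h. h *\<^sub>C d)" by (rule scaleC.bounded_linear_left)
    show "(\<lambda>h. norm (gauss_average u (z + h) - gauss_average u z - h *\<^sub>C d) / norm h) \<midarrow>0\<rightarrow> 0"
    proof (rule tendsto_0_le[of cmod _ _ C])
      show "(\<lambda>h. cmod h) \<midarrow>0\<rightarrow> 0" using tendsto_norm_zero[OF tendsto_ident_at] .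
      have "\<forall>\<^sub>F h in at 0. cmod h \<le> 1"
        by (auto simp: eventually_at intro!: exI[of _ 1])
      then show "\<forall>\<^sub>F h in at 0. norm (norm (gauss_average u (z + h) - gauss_average u z - h *\<^sub>C d)
          / norm h) \<le> norm (cmod h) * C"
        by eventually_elim (use quad in \<open>auto simp: divide_le_eq power2_eq_square mult_ac\<close>)
    qed
  qed
  then show "\<exists>d. (gauss_average u has_derivative (\<lambda>h. h *\<^sub>C d)) (at z)" by blast
qed

end

section \<open>Smoothing of orbits\<close>

definition gauss_mass :: real
  where "gauss_mass = integral UNIV (\<lambda>t. exp (- t\<^sup>2))"

definition gauss_smoothing ::
    "(real \<Rightarrow> 'a :: unital_cstar_algebra \<Rightarrow> 'a) \<Rightarrow> 'a \<Rightarrow> complex \<Rightarrow> 'a"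
  where "gauss_smoothing \<alpha> a z = (1 / gauss_mass) *\<^sub>R gauss_average (\<lambda>t. \<alpha> t a) z"

lemma gauss_zero: "gauss 0 t = complex_of_real (exp (- t\<^sup>2))"
  unfolding gauss_def exp_of_real[symmetric] by simp

lemma exp_minus_square_integrable: "(\<lambda>t :: real. exp (- t\<^sup>2)) integrable_on UNIV"
  using gauss_le[of 0]
  by (intro exp_dominated_integrable(1)[where K = "gauss_bound 0"] continuous_intros)
    (simp add: gauss_zero)

lemma abs_exp_minus_square_integrable: "(\<lambda>t :: real. \<bar>t\<bar> * exp (- t\<^sup>2)) integrable_on UNIV"
proof (rule exp_dominated_integrable(1)[where K = "gauss_bound 0"])
  show "continuous_on UNIV (\<lambda>t :: real. \<bar>t\<bar> * exp (- t\<^sup>2))" by (intro continuous_intros)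
  fix t :: real
  have "\<bar>t\<bar> \<le> exp (4 * \<bar>t\<bar> + 2)"
    using exp_ge_add_one_self[of "4 * \<bar>t\<bar> + 2"] by linarith
  then have "exp (- t\<^sup>2) * \<bar>t\<bar> \<le> exp (- t\<^sup>2) * exp (4 * \<bar>t\<bar> + 2)"
    by (rule mult_left_mono) simp
  also have "\<dots> \<le> gauss_bound 0 * exp (- \<bar>t\<bar>)"
    using gauss_decay[of 0 t] by (simp add: gauss_zero del: of_real_exp)
  finally show "norm (\<bar>t\<bar> * exp (- t\<^sup>2)) \<le> gauss_bound 0 * exp (- \<bar>t\<bar>)"
    by (simp add: abs_mult mult.commute)
qed

lemma gauss_mass_pos: "0 < gauss_mass"
proof -
  have "exp (- 1) = integral {0..1 :: real} (\<lambda>t. exp (- 1) :: real)" by simp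
  also have "\<dots> \<le> integral {0..1} (\<lambda>t :: real. exp (- t\<^sup>2))"
    by (intro integral_le integrable_continuous_interval continuous_intros)
      (auto simp: power_le_one)
  also have "\<dots> \<le> gauss_mass"
    unfolding gauss_mass_def
    by (intro integral_subset_le exp_minus_square_integrable integrable_continuous_interval
        continuous_intros) auto
  finally show ?thesis by (rule less_le_trans[OF exp_gt_zero])
qed

text \<open>An upper bound for the total variation of the normalised complex Gaussian weights.\<close>

definition gauss_weight :: "complex \<Rightarrow> real"
  where "gauss_weight z = gauss_bound z * integral UNIV (\<lambda>t. exp (- \<bar>t\<bar>)) / gauss_mass"

context cstar_action
begin

lemma orbit_path: "bounded_path (\<lambda>t. \<alpha> t a) (norm a)"
  by unfold_locales (simp_all add: continuous norm_\<alpha>_le)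

lemma smoothing_translate:
  "gauss_smoothing \<alpha> a (z + complex_of_real s) = \<alpha> s (gauss_smoothing \<alpha> a z)"
proof -
  have "(\<lambda>t. \<alpha> (t + s) a) = (\<lambda>t. \<alpha> s (\<alpha> t a))" by (simp add: add.commute[of _ s] \<alpha>_add)
  then show ?thesis
    by (simp add: gauss_smoothing_def bounded_path.gauss_average_translate[OF orbit_path]
        bounded_path.gauss_average_automorphism[OF orbit_path automorphism] \<alpha>_simps)
qed

lemma smoothing_extension:
  "analytic_extension \<alpha> (gauss_smoothing \<alpha> a z) (\<lambda>w. gauss_smoothing \<alpha> a (w + z))"
proof -
  have "entire (gauss_smoothing \<alpha> a)"
    unfolding gauss_smoothing_def[abs_def]
    by (rule entire_scaleR[OF bounded_path.entire_gauss_average[OF orbit_path]])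
  from entire_affine[OF this, of 1 z] show ?thesis
    by (simp add: analytic_extension_def add.commute[of _ z] smoothing_translate)
qed

lemma smoothing_mem: "gauss_smoothing \<alpha> a z \<in> entire_elements \<alpha>"
  by (rule extension_mem[OF smoothing_extension])

lemma smoothing_one_zero: "gauss_smoothing \<alpha> 1 0 = 1"
proof -
  have "gauss_average (\<lambda>t. 1) 0 = integral UNIV (\<lambda>t. exp (- t\<^sup>2) *\<^sub>R (1 :: 'a))"
    by (simp add: gauss_average_def gauss_zero scaleC_of_real del: of_real_exp)
  also have "\<dots> = gauss_mass *\<^sub>R 1"
    unfolding gauss_mass_def
    using integral_linear[OF exp_minus_square_integrable bounded_linear_scaleR_left, of "1 :: 'a"]
    by (simp add: o_def)
  finally show ?thesis
    using gauss_mass_pos by (simp add: gauss_smoothing_def \<alpha>_simps)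
qed

text \<open>
  The complex Gaussian weights also have total mass one, by uniqueness of the analytic extension
  of the fixed point \<open>1\<close>.
\<close>

lemma functional_smoothing_one:
  assumes "bounded_functional \<phi>"
  shows "\<phi> (gauss_smoothing \<alpha> 1 z) = \<phi> 1"
proof -
  have "analytic_extension \<alpha> 1 (\<lambda>w. gauss_smoothing \<alpha> 1 w)"
    using smoothing_extension[of 1 0] by (simp add: smoothing_one_zero)
  from extension_unique[OF this extension_const assms] show ?thesis by simp
qed

lemma functional_smoothing_le:
  assumes \<phi>: "bounded_functional \<phi>" and \<psi>: "bounded_functional \<psi>"
    and le: "\<And>t. cmod (\<phi> (\<alpha> t a) - \<psi> (\<alpha> t b)) \<le> e"
  shows "cmod (\<phi> (gauss_smoothing \<alpha> a z) - \<psi> (gauss_smoothing \<alpha> b z)) \<le> e * gauss_weight z"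
proof -
  interpret u: bounded_path "\<lambda>t. \<alpha> t a" "norm a" by (rule orbit_path)
  interpret v: bounded_path "\<lambda>t. \<alpha> t b" "norm b" by (rule orbit_path)
  define F where "F t = gauss z t * \<phi> (\<alpha> t a) - gauss z t * \<psi> (\<alpha> t b)" for t
  have F: "(F has_integral \<phi> (gauss_average (\<lambda>t. \<alpha> t a) z) - \<psi> (gauss_average (\<lambda>t. \<alpha> t b) z)) UNIV"
    unfolding F_def[abs_def]
    by (intro has_integral_diff u.functional_gauss_average v.functional_gauss_average \<phi> \<psi>)
  have "continuous_on UNIV F"
    unfolding F_def[abs_def]
    by (intro continuous_intros continuous_gauss continuous
        bounded_linear.continuous_on[OF bounded_functional_bounded_linear[OF \<phi>]]
        bounded_linear.continuous_on[OF bounded_functional_bounded_linear[OF \<psi>]])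
  moreover have "cmod (F t) \<le> (e * gauss_bound z) * exp (- \<bar>t\<bar>)" for t
  proof -
    have "cmod (F t) = cmod (gauss z t) * cmod (\<phi> (\<alpha> t a) - \<psi> (\<alpha> t b))"
      by (simp add: F_def norm_mult flip: right_diff_distrib)
    also have "\<dots> \<le> (gauss_bound z * exp (- \<bar>t\<bar>)) * e"
      by (intro mult_mono gauss_le le) (auto simp: gauss_bound_def)
    finally show ?thesis by (simp add: mult_ac)
  qed
  ultimately have *: "cmod (integral UNIV F) \<le> (e * gauss_bound z) * integral UNIV (\<lambda>t. exp (- \<bar>t\<bar>))"
    by (rule exp_dominated_integrable(2))
  have "\<phi> (gauss_smoothing \<alpha> a z) - \<psi> (gauss_smoothing \<alpha> b z) = complex_of_real (1 / gauss_mass) * integral UNIV F"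
    using integral_unique[OF F] unfolding gauss_smoothing_def
    by (simp add: linear_functionalD[OF bounded_functional_linear[OF \<phi>]]
        linear_functionalD[OF bounded_functional_linear[OF \<psi>]] right_diff_distrib diff_divide_distrib)
  then have "cmod (\<phi> (gauss_smoothing \<alpha> a z) - \<psi> (gauss_smoothing \<alpha> b z))
      = cmod (integral UNIV F) / gauss_mass"
    using gauss_mass_pos by (simp add: norm_mult norm_divide)
  also have "\<dots> \<le> e * gauss_weight z"
    using divide_right_mono[OF *, of gauss_mass] gauss_mass_pos
    by (simp add: gauss_weight_def mult_ac)
  finally show ?thesis .
qed

lemma norm_smoothing_minus_le:
  assumes le: "\<And>t. norm (\<alpha> t a - a) \<le> e + c * \<bar>t\<bar>"
  shows "norm (gauss_smoothing \<alpha> a 0 - a)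
    \<le> e + c * (integral UNIV (\<lambda>t. \<bar>t\<bar> * exp (- t\<^sup>2)) / gauss_mass)"
proof -
  define M where "M = integral UNIV (\<lambda>t :: real. \<bar>t\<bar> * exp (- t\<^sup>2))"
  interpret u: bounded_path "\<lambda>t. \<alpha> t a" "norm a" by (rule orbit_path)
  have 1: "(\<lambda>t. exp (- t\<^sup>2) *\<^sub>R \<alpha> t a) integrable_on UNIV"
      "integral UNIV (\<lambda>t. exp (- t\<^sup>2) *\<^sub>R \<alpha> t a) = gauss_mass *\<^sub>R gauss_smoothing \<alpha> a 0"
    using u.integrable_gauss[of 0] gauss_mass_pos
    by (simp_all add: gauss_smoothing_def gauss_average_def gauss_zero scaleC_of_real
        del: of_real_exp)
  have 2: "(\<lambda>t. exp (- t\<^sup>2) *\<^sub>R a) integrable_on UNIV"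
      "integral UNIV (\<lambda>t. exp (- t\<^sup>2) *\<^sub>R a) = gauss_mass *\<^sub>R a"
    using integral_linear[OF exp_minus_square_integrable bounded_linear_scaleR_left, of a]
      integrable_linear[OF exp_minus_square_integrable bounded_linear_scaleR_left, of a]
    by (simp_all add: o_def gauss_mass_def)
  have 3: "(\<lambda>t. exp (- t\<^sup>2) *\<^sub>R (\<alpha> t a - a)) integrable_on UNIV"
      "integral UNIV (\<lambda>t. exp (- t\<^sup>2) *\<^sub>R (\<alpha> t a - a))
        = gauss_mass *\<^sub>R (gauss_smoothing \<alpha> a 0 - a)"
    using integrable_diff[OF 1(1) 2(1)] integral_diff[OF 1(1) 2(1)]
    by (simp_all add: 1(2) 2(2) scaleR_diff_right)
  have g: "((\<lambda>t. e * exp (- t\<^sup>2) + c * (\<bar>t\<bar> * exp (- t\<^sup>2))) has_integral (e * gauss_mass + c * M)) UNIV"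
    unfolding gauss_mass_def M_def
    by (intro has_integral_add has_integral_mult_right integrable_integral
        exp_minus_square_integrable abs_exp_minus_square_integrable)
  have "norm (integral UNIV (\<lambda>t. exp (- t\<^sup>2) *\<^sub>R (\<alpha> t a - a)))
      \<le> integral UNIV (\<lambda>t. e * exp (- t\<^sup>2) + c * (\<bar>t\<bar> * exp (- t\<^sup>2)))"
  proof (rule integral_norm_bound_integral[OF 3(1) has_integral_integrable[OF g]])
    fix t :: real
    have "norm (exp (- t\<^sup>2) *\<^sub>R (\<alpha> t a - a)) = exp (- t\<^sup>2) * norm (\<alpha> t a - a)" by simp
    also have "\<dots> \<le> exp (- t\<^sup>2) * (e + c * \<bar>t\<bar>)" by (intro mult_left_mono le) simp
    also have "\<dots> = e * exp (- t\<^sup>2) + c * (\<bar>t\<bar> * exp (- t\<^sup>2))" by (simp add: algebra_simps)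
    finally show "norm (exp (- t\<^sup>2) *\<^sub>R (\<alpha> t a - a))
        \<le> e * exp (- t\<^sup>2) + c * (\<bar>t\<bar> * exp (- t\<^sup>2))" .
  qed
  then have "gauss_mass * norm (gauss_smoothing \<alpha> a 0 - a) \<le> e * gauss_mass + c * M"
    using gauss_mass_pos by (simp add: 3(2) integral_unique[OF g])
  then show ?thesis
    using gauss_mass_pos by (simp add: M_def field_simps)
qed

lemma rescaled: "cstar_action (\<lambda>t. \<alpha> (r * t))"
proof
  have "continuous_on UNIV (\<lambda>t. \<alpha> (r * t) a)" for a
    by (rule continuous_on_compose2[OF continuous]) (auto intro!: continuous_intros)
  moreover have "\<alpha> (r * (s + t)) a = \<alpha> (r * s) (\<alpha> (r * t) a)" for s t a
    by (simp add: distrib_left \<alpha>_add)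
  ultimately show "strongly_continuous_action (\<lambda>t. \<alpha> (r * t))"
    by (auto simp: strongly_continuous_action_def automorphism)
qed

lemma rescaled_entire_elements:
  assumes "r \<noteq> 0" "a \<in> entire_elements (\<lambda>t. \<alpha> (r * t))"
  shows "a \<in> entire_elements \<alpha>"
proof -
  obtain f where f: "entire f" "\<And>t. f (complex_of_real t) = \<alpha> (r * t) a"
    using assms(2) by (auto simp: entire_elements_def analytic_extension_def)
  have "analytic_extension \<alpha> a (\<lambda>z. f (complex_of_real (1 / r) * z))"
    unfolding analytic_extension_def
  proof
    show "entire (\<lambda>z. f (complex_of_real (1 / r) * z))"
      using entire_affine[OF f(1), of "complex_of_real (1 / r)" 0] by simp
    show "\<forall>t. f (complex_of_real (1 / r) * complex_of_real t) = \<alpha> t a"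
      using f(2)[of "t / r" for t] assms(1) by simp
  qed
  then show ?thesis by (rule extension_mem)
qed

text \<open>
  Rescaling time by a small \<open>r\<close> sharpens the Gaussian without changing the notion of an entire
  element.
\<close>

lemma entire_elements_dense:
  assumes e: "0 < e"
  obtains b where "b \<in> entire_elements \<alpha>" "norm (b - a) < e"
proof -
  define M where "M = integral UNIV (\<lambda>t :: real. \<bar>t\<bar> * exp (- t\<^sup>2)) / gauss_mass"
  have M: "0 \<le> M"
    unfolding M_def using gauss_mass_pos
    by (intro divide_nonneg_pos integral_nonneg abs_exp_minus_square_integrable) auto
  have "isCont (\<lambda>t. \<alpha> t a) 0"
    using continuous[of a] by (simp add: continuous_on_eq_continuous_at)
  then have "\<exists>d>0. \<forall>t. dist t 0 < d \<longrightarrow> dist (\<alpha> t a) (\<alpha> 0 a) < e / 2"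
    using half_gt_zero[OF e] unfolding continuous_at_eps_delta by blast
  then obtain d where d: "0 < d" "\<And>t. \<bar>t\<bar> < d \<Longrightarrow> norm (\<alpha> t a - a) < e / 2"
    unfolding dist_norm by auto
  \<comment> \<open>Chosen so that the trivial bound \<open>2 \<parallel>a\<parallel>\<close> is at most \<open>c \<bar>t\<bar>\<close> as soon as \<open>\<bar>t\<bar> \<ge> d\<close>.\<close>
  define c where "c = 2 * norm a / d"
  have c: "0 \<le> c" using d by (simp add: c_def)
  have bound: "norm (\<alpha> t a - a) \<le> e / 2 + c * \<bar>t\<bar>" for t
  proof (cases "\<bar>t\<bar> < d")
    case True
    have "0 \<le> c * \<bar>t\<bar>" using c by simp
    with d(2)[OF True] show ?thesis by linarith
  next
    case False
    have "norm (\<alpha> t a - a) \<le> 2 * norm a"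
      using norm_triangle_ineq4[of "\<alpha> t a" a] norm_\<alpha>_le[of t a] by linarith
    also have "\<dots> = c * d" using d by (simp add: c_def)
    also have "\<dots> \<le> c * \<bar>t\<bar>" using False c by (intro mult_left_mono) auto
    finally show ?thesis using e by linarith
  qed
  define r where "r = e / (4 * (c * M + 1))"
  have cM: "0 \<le> c * M" using c M by simp
  then have r: "0 < r" using e by (simp add: r_def)
  have "r * (c * M) \<le> e / 4"
    using e cM by (simp add: r_def field_simps)
  interpret R: cstar_action "\<lambda>t. \<alpha> (r * t)" by (rule rescaled)
  have "norm (gauss_smoothing (\<lambda>t. \<alpha> (r * t)) a 0 - a) \<le> e / 2 + (c * r) * M"
    unfolding M_def
  proof (rule R.norm_smoothing_minus_le)
    show "norm (\<alpha> (r * t) a - a) \<le> e / 2 + (c * r) * \<bar>t\<bar>" for t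
      using bound[of "r * t"] r by (simp add: abs_mult mult.assoc)
  qed
  also have "\<dots> < e" using \<open>r * (c * M) \<le> e / 4\<close> e by (simp add: mult_ac)
  finally show ?thesis
    using r by (intro that[OF rescaled_entire_elements[OF _ R.smoothing_mem]]) auto
qed

lemma bounded_functional_eqI:
  assumes \<phi>: "bounded_functional \<phi>" and \<psi>: "bounded_functional \<psi>"
    and eq: "\<And>a. a \<in> entire_elements \<alpha> \<Longrightarrow> \<phi> a = \<psi> a"
  shows "\<phi> a = \<psi> a"
proof -
  have "\<exists>b. b \<in> entire_elements \<alpha> \<and> norm (b - a) < 1 / real (Suc n)" for n
    by (rule entire_elements_dense[of "1 / real (Suc n)" a]) auto
  then obtain b where b: "\<And>n. b n \<in> entire_elements \<alpha>" "\<And>n. norm (b n - a) < 1 / real (Suc n)"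
    by metis
  have "(\<lambda>n. b n - a) \<longlonglongrightarrow> 0"
    by (rule LIMSEQ_norm_0) (rule b(2))
  then have lim: "b \<longlonglongrightarrow> a" by (simp add: LIM_zero_iff)
  have "(\<lambda>n. \<phi> (b n)) \<longlonglongrightarrow> \<phi> a" "(\<lambda>n. \<psi> (b n)) \<longlonglongrightarrow> \<psi> a"
    by (rule bounded_functional_continuous[OF \<phi> lim], rule bounded_functional_continuous[OF \<psi> lim])
  then show ?thesis using eq[OF b(1)] by (simp add: LIMSEQ_unique)
qed

section \<open>Invariance from the KMS condition\<close>

text \<open>
  For entire \<open>b\<close> the function \<open>z \<mapsto> \<phi>(\<alpha>\<^sub>z(b))\<close> has period \<open>\<i>\<beta>\<close>. It is bounded on a period
  strip because the \<open>\<alpha>\<^sub>t\<close> are isometric, hence constant by Liouville's theorem.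
\<close>

lemma periodic_functional_invariant:
  assumes \<phi>: "bounded_functional \<phi>" and \<beta>: "\<beta> \<noteq> 0"
    and per: "\<And>b. b \<in> entire_elements \<alpha> \<Longrightarrow> \<phi> (complex_time \<alpha> (\<i> * complex_of_real \<beta>) b) = \<phi> b"
  shows "\<phi> (\<alpha> t a) = \<phi> a"
proof (rule bounded_functional_eqI[OF bounded_functional_automorphism[OF \<phi> automorphism] \<phi>])
  fix b assume "b \<in> entire_elements \<alpha>"
  then obtain f where f: "analytic_extension \<alpha> b f" by (auto simp: entire_elements_def)
  define h where "h z = \<phi> (f z)" for z
  have ent: "entire f" and real: "\<And>t. f (complex_of_real t) = \<alpha> t b"
    using f by (simp_all add: analytic_extension_def)
  have hol: "h holomorphic_on UNIV"
    unfolding h_def[abs_def] by (rule entire_holomorphic[OF ent \<phi>])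
  define p where "p = \<i> * complex_of_real \<beta>"
  have period: "h (z + p) = h z" for z
  proof (rule holomorphic_eq_if_eq_on_reals[of "\<lambda>z. h (z + p)" h z])
    show "(\<lambda>z. h (z + p)) holomorphic_on UNIV"
      by (rule holomorphic_on_compose_gen[OF _ hol, unfolded o_def, of "\<lambda>z. z + p"])
        (auto intro!: holomorphic_intros)
    show "h (complex_of_real s + p) = h (complex_of_real s)" for s
      using complex_time_eq[OF extension_shift[OF f, of s] \<phi>, of p]
        per[OF extension_mem[OF extension_shift[OF f, of s]]]
      by (simp add: h_def real p_def add.commute)
  qed (rule hol)
  have periods: "h (z + of_nat n * p) = h z" for z n
  proof (induction n arbitrary: z)
    case (Suc n)
    have "h (z + of_nat (Suc n) * p) = h ((z + of_nat n * p) + p)" by (simp add: algebra_simps)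
    with Suc period show ?case by metis
  qed simp
  have int_periods: "h (z - of_int k * p) = h z" for z k
  proof (cases "0 \<le> k")
    case True
    then show ?thesis using periods[of "z - of_int k * p" "nat k"] by simp
  next
    case False
    then show ?thesis using periods[of z "nat (- k)"] by simp
  qed
  have cont: "continuous_on UNIV f"
    using ent unfolding entire_def
    by (meson continuous_at_imp_continuous_on has_derivative_continuous)
  have "compact ((\<lambda>y. f (p * complex_of_real y)) ` {0..1})"
    by (intro compact_continuous_image continuous_on_compose2[OF cont] continuous_intros) auto
  then have "bounded ((\<lambda>y. f (p * complex_of_real y)) ` {0..1})" by (rule compact_imp_bounded)
  then obtain B where B: "\<And>y. y \<in> {0..1} \<Longrightarrow> norm (f (p * complex_of_real y)) \<le> B"
    unfolding bounded_iff by (auto simp del: atLeastAtMost_iff)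
  obtain K where K: "\<And>a. cmod (\<phi> a) \<le> K * norm a"
    using \<phi> unfolding bounded_functional_def by blast
  have "0 \<le> K" using K[of 1] norm_ge_zero[of "\<phi> 1"] by (simp del: norm_ge_zero)
  have "cmod (h z) \<le> K * B" for z
  proof -
    define k where "k = \<lfloor>Im z / \<beta>\<rfloor>"
    define y where "y = Im z / \<beta> - real_of_int k"
    have y: "y \<in> {0..1}" unfolding y_def k_def by (auto; linarith)
    have "z - of_int k * p = p * complex_of_real y + complex_of_real (Re z)"
      using \<beta> by (simp add: complex_eq_iff p_def y_def field_simps)
    then have "h z = \<phi> (f (p * complex_of_real y + complex_of_real (Re z)))"
      using int_periods[of z k] by (simp add: h_def)
    also have "\<dots> = \<phi> (\<alpha> (Re z) (f (p * complex_of_real y)))"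
      by (rule extension_unique[OF extension_shift[OF f] extension_action[OF f] \<phi>])
    finally have "cmod (h z) \<le> K * norm (\<alpha> (Re z) (f (p * complex_of_real y)))"
      using K by simp
    also have "\<dots> \<le> K * B"
      by (rule mult_left_mono[OF order_trans[OF norm_\<alpha>_le B[OF y]] \<open>0 \<le> K\<close>])
    finally show ?thesis .
  qed
  then have "bounded (range h)" by (auto simp: bounded_iff)
  then have "h constant_on UNIV" by (rule Liouville_theorem[OF hol])
  then have "h (complex_of_real t) = h (complex_of_real 0)" by (auto simp: constant_on_def)
  then show "\<phi> (\<alpha> t b) = \<phi> b" unfolding h_def real by simp
qed

text \<open>
  Both sides are bounded functionals of \<open>a\<close>, so density of the entire elements removes the
  restriction on \<open>a\<close>. The two cases of interest are \<open>\<theta> = id\<close> for the state and \<open>\<theta> = \<gamma>\<close> for the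
  twisted functionals.
\<close>

lemma twisted_KMS_extend:
  assumes \<phi>: "bounded_functional \<phi>" and \<theta>: "star_automorphism \<theta>"
    and KMS: "\<And>a b. a \<in> entire_elements \<alpha> \<Longrightarrow> b \<in> entire_elements \<alpha> \<Longrightarrow>
        \<phi> (a * complex_time \<alpha> z b) = \<phi> (b * \<theta> a)"
    and b: "analytic_extension \<alpha> b g"
  shows "\<phi> (a * g z) = \<phi> (b * \<theta> a)"
proof (rule bounded_functional_eqI[of "\<lambda>a. \<phi> (a * g z)" "\<lambda>a. \<phi> (b * \<theta> a)" a])
  show "bounded_functional (\<lambda>a. \<phi> (a * g z))" by (rule bounded_functional_mult_right[OF \<phi>])
  show "bounded_functional (\<lambda>a. \<phi> (b * \<theta> a))"
    by (rule bounded_functional_automorphism[OF bounded_functional_mult_left[OF \<phi>] \<theta>])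
  show "\<phi> (a * g z) = \<phi> (b * \<theta> a)" if "a \<in> entire_elements \<alpha>" for a
    using KMS[OF that extension_mem[OF b]]
      complex_time_eq[OF b bounded_functional_mult_left[OF \<phi>, of a], where z = z] by simp
qed

lemma twisted_KMS_invariant:
  assumes \<phi>: "bounded_functional \<phi>" and \<theta>: "star_automorphism \<theta>" and \<beta>: "\<beta> \<noteq> 0"
    and KMS: "\<And>a b. a \<in> entire_elements \<alpha> \<Longrightarrow> b \<in> entire_elements \<alpha> \<Longrightarrow>
        \<phi> (a * complex_time \<alpha> (\<i> * complex_of_real \<beta>) b) = \<phi> (b * \<theta> a)"
  shows "\<phi> (\<alpha> t a) = \<phi> a" "\<phi> (\<theta> a) = \<phi> a"
proof -
  show "\<phi> (\<alpha> t a) = \<phi> a"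
    using KMS[OF extension_mem[OF extension_const]]
    by (intro periodic_functional_invariant[OF \<phi> \<beta>]) (simp add: star_automorphismD[OF \<theta>])
  show "\<phi> (\<theta> a) = \<phi> a"
    using twisted_KMS_extend[OF \<phi> \<theta> KMS extension_const, of a] by simp
qed

end

context cstar_state
begin

lemma approximates_nrm_bounded:
  assumes c: "approximates \<omega> c \<rho>" and \<rho>: "dominated_by \<omega> \<rho>"
  obtains K where "0 \<le> K" "\<And>n. nrm (c n) \<le> K"
proof -
  obtain \<epsilon> where \<epsilon>: "\<epsilon> \<longlonglongrightarrow> 0" "\<And>n x. cmod (\<omega> (adj (c n) * x) - \<rho> x) \<le> \<epsilon> n * nrm x"
    using c unfolding approximates_def by blast
  have "nrm (c n) \<le> 1 + \<epsilon> n" for n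
  proof (cases "nrm (c n) = 0")
    case True
    have "0 \<le> \<epsilon> n" using order_trans[OF norm_ge_zero \<epsilon>(2)[of n 1]] by simp
    with True show ?thesis by simp
  next
    case False
    have "(nrm (c n))\<^sup>2 \<le> cmod (\<omega> (adj (c n) * c n))"
      by (simp add: nrm_square norm_power)
    also have "\<dots> \<le> cmod (\<rho> (c n)) + cmod (\<omega> (adj (c n) * c n) - \<rho> (c n))"
      by (metis add.commute norm_triangle_sub)
    also have "\<dots> \<le> nrm (c n) + \<epsilon> n * nrm (c n)"
      by (intro add_mono dominated_le_nrm[OF \<rho>] \<epsilon>(2))
    finally have "nrm (c n) * nrm (c n) \<le> (1 + \<epsilon> n) * nrm (c n)"
      by (simp add: power2_eq_square distrib_right)
    moreover have "0 < nrm (c n)" using False nrm_nonneg[of "c n"] by linarith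
    ultimately show ?thesis by simp
  qed
  moreover obtain B where "\<And>n. \<bar>\<epsilon> n\<bar> \<le> B"
    using convergent_imp_Bseq[OF convergentI[OF \<epsilon>(1)]] unfolding Bseq_def by auto
  ultimately have "nrm (c n) \<le> \<bar>1 + B\<bar>" for n
    by (smt (verit))
  then show ?thesis by (intro that[of "\<bar>1 + B\<bar>"]) auto
qed

lemma approximates_left:
  assumes c: "approximates \<omega> c \<rho>" and x: "\<And>n. nrm (x n) \<le> K"
  shows "(\<lambda>n. \<omega> (adj (c n) * x n) - \<rho> (x n)) \<longlonglongrightarrow> 0"
proof -
  obtain \<epsilon> where \<epsilon>: "\<epsilon> \<longlonglongrightarrow> 0" "\<And>n x. cmod (\<omega> (adj (c n) * x) - \<rho> x) \<le> \<epsilon> n * nrm x"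
    using c unfolding approximates_def by blast
  have "cmod (\<omega> (adj (c n) * x n) - \<rho> (x n)) \<le> \<epsilon> n * K" for n
  proof -
    have "0 \<le> \<epsilon> n" using order_trans[OF norm_ge_zero \<epsilon>(2)[of n 1]] by simp
    then show ?thesis using \<epsilon>(2)[of n "x n"] mult_left_mono[OF x] order_trans by blast
  qed
  moreover have "(\<lambda>n. \<epsilon> n * K) \<longlonglongrightarrow> 0" using tendsto_mult_left_zero[OF \<epsilon>(1)] .
  ultimately show ?thesis by (rule Lim_null_comparison[OF always_eventually, OF allI])
qed

lemma approximates_right:
  assumes c: "approximates \<omega> c \<rho>" and herm: "\<And>a. \<rho> (adj a) = cnj (\<rho> a)"
    and x: "\<And>n. nrm (adj (x n)) \<le> K"
  shows "(\<lambda>n. \<omega> (x n * c n) - \<rho> (x n)) \<longlonglongrightarrow> 0"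
proof -
  have "\<omega> (x n * c n) - \<rho> (x n) = cnj (\<omega> (adj (c n) * adj (x n)) - \<rho> (adj (x n)))" for n
    using adj[of "x n * c n"] by (simp add: herm adj_mult)
  then show ?thesis
    using tendsto_cnj[OF approximates_left[OF c x]] by simp
qed

lemma approximates_tendsto:
  assumes c: "approximates \<omega> c \<rho>" and herm: "\<And>a. \<rho> (adj a) = cnj (\<rho> a)"
  shows "(\<lambda>n. \<omega> (adj (c n) * x)) \<longlonglongrightarrow> \<rho> x" "(\<lambda>n. \<omega> (x * c n)) \<longlonglongrightarrow> \<rho> x"
  using approximates_left[where x = "\<lambda>_. x", OF c order_refl]
    approximates_right[where x = "\<lambda>_. x", OF c herm order_refl]
  by (simp_all add: LIM_zero_iff)

section \<open>Products in the commutant\<close>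

text \<open>
  Let \<open>T\<^sub>\<rho>\<close> be the operator in the commutant with \<open>\<rho> = \<langle>\<Omega>, T\<^sub>\<rho> \<pi>(\<cdot>)\<Omega>\<rangle>\<close>. This is the functional
  \<open>\<langle>\<Omega>, T\<^sub>\<rho> T\<^sub>\<sigma> \<pi>(\<cdot>)\<Omega>\<rangle>\<close>; the choice of the approximating sequence does not affect the limit.
\<close>

definition product :: "('a \<Rightarrow> complex) \<Rightarrow> ('a \<Rightarrow> complex) \<Rightarrow> 'a \<Rightarrow> complex"
  where "product \<rho> \<sigma> x = lim (\<lambda>n. \<sigma> (adj ((SOME c. approximates \<omega> c \<rho>) n) * x))"

lemma approximates_nrm_diff:
  assumes "approximates \<omega> c \<rho>" "approximates \<omega> d \<rho>"
  obtains \<epsilon> \<delta> where "\<epsilon> \<longlonglongrightarrow> 0" "\<delta> \<longlonglongrightarrow> 0" "\<And>n m. nrm (c n - d m) \<le> \<epsilon> n + \<delta> m"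
proof -
  obtain \<epsilon> where \<epsilon>: "\<epsilon> \<longlonglongrightarrow> 0" "\<And>n x. cmod (\<omega> (adj (c n) * x) - \<rho> x) \<le> \<epsilon> n * nrm x"
    using assms(1) unfolding approximates_def by blast
  obtain \<delta> where \<delta>: "\<delta> \<longlonglongrightarrow> 0" "\<And>n x. cmod (\<omega> (adj (d n) * x) - \<rho> x) \<le> \<delta> n * nrm x"
    using assms(2) unfolding approximates_def by blast
  have "nrm (c n - d m) \<le> \<epsilon> n + \<delta> m" for n m
  proof -
    define x where "x = c n - d m"
    have "0 \<le> \<epsilon> n" using order_trans[OF norm_ge_zero \<epsilon>(2)[of n 1]] by simp
    moreover have "0 \<le> \<delta> m" using order_trans[OF norm_ge_zero \<delta>(2)[of m 1]] by simp
    ultimately have nonneg: "0 \<le> \<epsilon> n + \<delta> m" by simp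
    have "\<omega> (adj x * x) = (\<omega> (adj (c n) * x) - \<rho> x) - (\<omega> (adj (d m) * x) - \<rho> x)"
      by (simp add: x_def adj_diff left_diff_distrib lin)
    then have "cmod (\<omega> (adj x * x)) \<le> \<epsilon> n * nrm x + \<delta> m * nrm x"
      using norm_triangle_ineq4[of "\<omega> (adj (c n) * x) - \<rho> x" "\<omega> (adj (d m) * x) - \<rho> x"]
        \<epsilon>(2)[of n x] \<delta>(2)[of m x] by simp
    moreover have "cmod (\<omega> (adj x * x)) = (nrm x)\<^sup>2" by (simp add: nrm_square norm_power)
    ultimately have "nrm x * nrm x \<le> (\<epsilon> n + \<delta> m) * nrm x"
      by (simp add: power2_eq_square distrib_right)
    then show ?thesis
      using nonneg nrm_nonneg[of x] unfolding x_def[symmetric]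
      by (cases "nrm x = 0") auto
  qed
  with \<epsilon>(1) \<delta>(1) show ?thesis by (rule that)
qed

lemma product_tendsto:
  assumes c: "approximates \<omega> c \<rho>" and \<sigma>: "dominated_by \<omega> \<sigma>"
  shows "(\<lambda>n. \<sigma> (adj (c n) * x)) \<longlonglongrightarrow> product \<rho> \<sigma> x"
proof -
  note lin\<sigma> = linear_functionalD[OF dominated_linear[OF \<sigma>]]
  define d where "d = (SOME c. approximates \<omega> c \<rho>)"
  have d: "approximates \<omega> d \<rho>" unfolding d_def by (rule someI[where P = "\<lambda>c. approximates \<omega> c \<rho>", OF c])
  have "Cauchy (\<lambda>n. \<sigma> (adj (d n) * x))"
  proof (rule CauchyI')
    fix e :: real assume e: "0 < e"
    obtain \<epsilon> \<delta> where \<epsilon>: "\<epsilon> \<longlonglongrightarrow> 0" "\<delta> \<longlonglongrightarrow> 0" "\<And>n m. nrm (d n - d m) \<le> \<epsilon> n + \<delta> m"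
      using approximates_nrm_diff[OF d d] by blast
    define e' where "e' = e / (2 * (nrm x + 1))"
    have e': "0 < e'" using e nrm_nonneg[of x] by (simp add: e'_def add_nonneg_pos)
    obtain M1 where M1: "\<And>n. n \<ge> M1 \<Longrightarrow> \<epsilon> n < e'"
      using order_tendstoD(2)[OF \<epsilon>(1) e'] unfolding eventually_sequentially by blast
    obtain M2 where M2: "\<And>n. n \<ge> M2 \<Longrightarrow> \<delta> n < e'"
      using order_tendstoD(2)[OF \<epsilon>(2) e'] unfolding eventually_sequentially by blast
    show "\<exists>M. \<forall>m\<ge>M. \<forall>n>m. dist (\<sigma> (adj (d m) * x)) (\<sigma> (adj (d n) * x)) < e"
    proof (intro exI[of _ "max M1 M2"] allI impI)
      fix m n assume "max M1 M2 \<le> m" "m < n"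
      then have "nrm (d m - d n) \<le> 2 * e'"
        using \<epsilon>(3)[of m n] M1[of m] M2[of n] by simp
      moreover have "cmod (\<sigma> (adj (d m - d n) * x)) \<le> nrm (d m - d n) * nrm x"
        by (rule dominated_le[OF \<sigma>])
      ultimately have "cmod (\<sigma> (adj (d m - d n) * x)) \<le> 2 * e' * nrm x"
        using mult_right_mono[of "nrm (d m - d n)" "2 * e'" "nrm x"] by simp
      also have "\<dots> < 2 * e' * (nrm x + 1)" using e' by simp
      also have "\<dots> = e"
      proof -
        have "nrm x + 1 \<noteq> 0" using nrm_nonneg[of x] by linarith
        then show ?thesis by (simp add: e'_def field_simps)
      qed
      finally show "dist (\<sigma> (adj (d m) * x)) (\<sigma> (adj (d n) * x)) < e"
        by (simp add: dist_norm adj_diff left_diff_distrib lin\<sigma>)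
    qed
  qed
  then have lim_d: "(\<lambda>n. \<sigma> (adj (d n) * x)) \<longlonglongrightarrow> product \<rho> \<sigma> x"
    unfolding product_def d_def[symmetric] by (simp add: Cauchy_convergent_iff convergent_LIMSEQ_iff)
  obtain \<epsilon> \<delta> where \<epsilon>: "\<epsilon> \<longlonglongrightarrow> 0" "\<delta> \<longlonglongrightarrow> 0" "\<And>n m. nrm (c n - d m) \<le> \<epsilon> n + \<delta> m"
    using approximates_nrm_diff[OF c d] by blast
  have "(\<lambda>n. \<sigma> (adj (c n) * x) - \<sigma> (adj (d n) * x)) \<longlonglongrightarrow> 0"
  proof (rule Lim_null_comparison[OF always_eventually, OF allI])
    show "norm (\<sigma> (adj (c n) * x) - \<sigma> (adj (d n) * x)) \<le> (\<epsilon> n + \<delta> n) * nrm x" for n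
      using dominated_le[OF \<sigma>, of "c n - d n" x] mult_right_mono[OF \<epsilon>(3)[of n n], of "nrm x"]
      by (simp add: adj_diff left_diff_distrib lin\<sigma>)
    show "(\<lambda>n. (\<epsilon> n + \<delta> n) * nrm x) \<longlonglongrightarrow> 0"
      using tendsto_mult_left_zero[OF tendsto_add_zero[OF \<epsilon>(1,2)]] .
  qed
  from tendsto_add[OF this lim_d] show ?thesis by simp
qed

lemma product_tendsto_uniform:
  assumes c: "approximates \<omega> c \<rho>" and \<sigma>: "dominated_by \<omega> \<sigma>" and x: "\<And>n. nrm (x n) \<le> K"
  shows "(\<lambda>n. product \<rho> \<sigma> (x n) - \<sigma> (adj (c n) * x n)) \<longlonglongrightarrow> 0"
proof -
  note lin\<sigma> = linear_functionalD[OF dominated_linear[OF \<sigma>]]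
  obtain \<epsilon> \<delta> where \<epsilon>: "\<epsilon> \<longlonglongrightarrow> 0" "\<delta> \<longlonglongrightarrow> 0" "\<And>n m. nrm (c n - c m) \<le> \<epsilon> n + \<delta> m"
    using approximates_nrm_diff[OF c c] by blast
  have "cmod (product \<rho> \<sigma> (x n) - \<sigma> (adj (c n) * x n)) \<le> \<delta> n * nrm (x n)" for n
  proof (rule tendsto_le[OF sequentially_bot])
    show "(\<lambda>m. (\<epsilon> m + \<delta> n) * nrm (x n)) \<longlonglongrightarrow> \<delta> n * nrm (x n)"
      by (rule tendsto_eq_intros \<epsilon>(1) refl | simp)+
    show "(\<lambda>m. cmod (\<sigma> (adj (c m) * x n) - \<sigma> (adj (c n) * x n)))
        \<longlonglongrightarrow> cmod (product \<rho> \<sigma> (x n) - \<sigma> (adj (c n) * x n))"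
      by (intro tendsto_intros product_tendsto c \<sigma>)
    show "\<forall>\<^sub>F m in sequentially. cmod (\<sigma> (adj (c m) * x n) - \<sigma> (adj (c n) * x n))
        \<le> (\<epsilon> m + \<delta> n) * nrm (x n)"
    proof (rule always_eventually, rule allI)
      fix m
      show "cmod (\<sigma> (adj (c m) * x n) - \<sigma> (adj (c n) * x n)) \<le> (\<epsilon> m + \<delta> n) * nrm (x n)"
        using dominated_le[OF \<sigma>, of "c m - c n" "x n"]
          mult_right_mono[OF \<epsilon>(3)[of m n], of "nrm (x n)"]
        by (simp add: adj_diff left_diff_distrib lin\<sigma>)
    qed
  qed
  moreover have "\<delta> n * nrm (x n) \<le> \<bar>\<delta> n\<bar> * K" for n
    using mult_mono[OF abs_ge_self[of "\<delta> n"] x[of n]] by simp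
  ultimately have "cmod (product \<rho> \<sigma> (x n) - \<sigma> (adj (c n) * x n)) \<le> \<bar>\<delta> n\<bar> * K" for n
    using order_trans by blast
  moreover have "(\<lambda>n. \<bar>\<delta> n\<bar> * K) \<longlonglongrightarrow> 0"
    using tendsto_mult_left_zero[OF tendsto_rabs_zero[OF \<epsilon>(2)]] .
  ultimately show ?thesis by (rule Lim_null_comparison[OF always_eventually, OF allI])
qed

end

text \<open>\<open>T\<^sub>\<rho>\<close> and \<open>T\<^sub>\<sigma>\<close> are two self-adjoint contractions in the commutant.\<close>

locale dominated_pair = cstar_state +
  fixes \<rho> \<sigma> :: "'a \<Rightarrow> complex"
  assumes \<rho>: "dominated_by \<omega> \<rho>" and \<sigma>: "dominated_by \<omega> \<sigma>"
    and \<rho>_adj: "\<rho> (adj a) = cnj (\<rho> a)" and \<sigma>_adj: "\<sigma> (adj a) = cnj (\<sigma> a)"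
begin

lemma product_linear: "linear_functional (product \<rho> \<sigma>)"
proof -
  obtain c where c: "approximates \<omega> c \<rho>" using approximation_exists[OF \<rho>] .
  note lin\<sigma> = linear_functionalD[OF dominated_linear[OF \<sigma>]]
  note lim = product_tendsto[OF c \<sigma>]
  have "product \<rho> \<sigma> (a + b) = product \<rho> \<sigma> a + product \<rho> \<sigma> b" for a b
    using lim[of "a + b"] tendsto_add[OF lim[of a] lim[of b]]
    by (simp add: distrib_left lin\<sigma> LIMSEQ_unique)
  moreover have "product \<rho> \<sigma> (k *\<^sub>C a) = k * product \<rho> \<sigma> a" for k a
    using lim[of "k *\<^sub>C a"] tendsto_mult_left[OF lim[of a], of k]
    by (simp add: mult_scaleC_right lin\<sigma> LIMSEQ_unique)
  ultimately show ?thesis by (simp add: linear_functional_def)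
qed

lemma product_tendsto_diagonal:
  assumes c: "approximates \<omega> c \<rho>" and d: "approximates \<omega> d \<sigma>"
  shows "(\<lambda>n. \<omega> (adj (c n) * x * d n)) \<longlonglongrightarrow> product \<rho> \<sigma> x"
proof -
  obtain K where K: "\<And>n. nrm (c n) \<le> K" using approximates_nrm_bounded[OF c \<rho>] by blast
  have "nrm (adj (adj (c n) * x)) \<le> 2 * norm x * K" for n
    using nrm_mult[of "adj x" "c n"] mult_left_mono[OF K[of n], of "2 * norm x"]
    by (simp add: adj_mult adj_adj)
  from tendsto_add[OF approximates_right[where x = "\<lambda>n. adj (c n) * x", OF d \<sigma>_adj this] product_tendsto[OF c \<sigma>, of x]]
  show ?thesis by simp
qed

lemma product_tendsto_right:
  assumes d: "approximates \<omega> d \<sigma>"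
  shows "(\<lambda>n. \<rho> (x * d n)) \<longlonglongrightarrow> product \<rho> \<sigma> x"
proof -
  obtain c where c: "approximates \<omega> c \<rho>" using approximation_exists[OF \<rho>] .
  obtain K where K: "\<And>n. nrm (d n) \<le> K" using approximates_nrm_bounded[OF d \<sigma>] by blast
  have "nrm (x * d n) \<le> 2 * norm x * K" for n
    using nrm_mult[of x "d n"] mult_left_mono[OF K[of n], of "2 * norm x"] by simp
  from tendsto_diff[OF product_tendsto_diagonal[OF c d, of x] approximates_left[where x = "\<lambda>n. x * d n", OF c this]]
  show ?thesis by (simp add: mult.assoc)
qed

end

lemma (in dominated_pair) swapped: "dominated_pair \<omega> \<sigma> \<rho>"
  by unfold_locales (simp_all add: \<rho> \<sigma> \<rho>_adj \<sigma>_adj)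

lemma (in dominated_pair) diagonal: "dominated_pair \<omega> \<rho> \<rho>"
  by unfold_locales (simp_all add: \<rho> \<rho>_adj)

context dominated_pair
begin

lemma product_adj: "product \<rho> \<sigma> (adj x) = cnj (product \<sigma> \<rho> x)"
proof -
  obtain c where c: "approximates \<omega> c \<rho>" using approximation_exists[OF \<rho>] .
  obtain d where d: "approximates \<omega> d \<sigma>" using approximation_exists[OF \<sigma>] .
  have "\<omega> (adj (c n) * adj x * d n) = cnj (\<omega> (adj (d n) * x * c n))" for n
    using adj[of "adj (d n) * x * c n"] by (simp add: adj_mult adj_adj mult.assoc)
  then have "(\<lambda>n. cnj (\<omega> (adj (d n) * x * c n))) \<longlonglongrightarrow> product \<rho> \<sigma> (adj x)"
    using product_tendsto_diagonal[OF c d, of "adj x"] by simp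
  then show ?thesis
    using tendsto_cnj[OF dominated_pair.product_tendsto_diagonal[OF swapped d c, of x]]
    by (simp add: LIMSEQ_unique)
qed

text \<open>
  The number \<open>L = \<parallel>T\<^sub>\<rho> \<pi>(x)\<Omega>\<parallel>\<^sup>2\<close> is both the limit of \<open>\<parallel>x c\<^sub>n\<parallel>\<^sub>\<omega>\<^sup>2\<close> and that of \<open>\<rho>(x\<^sup>*(x c\<^sub>n))\<close>, so
  domination of \<open>\<rho>\<close> gives \<open>L\<^sup>2 \<le> \<parallel>x\<parallel>\<^sub>\<omega>\<^sup>2 L\<close>.
\<close>

lemma product_le: "cmod (product \<rho> \<sigma> (adj x * y)) \<le> nrm x * nrm y"
proof -
  obtain c where c: "approximates \<omega> c \<rho>" using approximation_exists[OF \<rho>] .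
  define L where "L = product \<rho> \<rho> (adj x * x)"
  have "(\<lambda>n. \<omega> (adj (c n) * (adj x * x) * c n)) \<longlonglongrightarrow> L"
    unfolding L_def by (rule dominated_pair.product_tendsto_diagonal[OF diagonal c c])
  then have "(\<lambda>n. complex_of_real ((nrm (x * c n))\<^sup>2)) \<longlonglongrightarrow> L"
    unfolding nrm_square[symmetric] by (simp add: adj_mult mult.assoc)
  then have sq: "(\<lambda>n. (nrm (x * c n))\<^sup>2) \<longlonglongrightarrow> cmod L"
    using tendsto_norm[of "\<lambda>n. complex_of_real ((nrm (x * c n))\<^sup>2)"] by (fastforce simp: norm_power)
  have "(\<lambda>n. \<rho> (adj x * x * c n)) \<longlonglongrightarrow> L"
    unfolding L_def by (rule dominated_pair.product_tendsto_right[OF diagonal c])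
  then have "(\<lambda>n. (cmod (\<rho> (adj x * (x * c n))))\<^sup>2) \<longlonglongrightarrow> (cmod L)\<^sup>2"
    by (auto intro!: tendsto_intros simp: mult.assoc)
  moreover have "(\<lambda>n. (nrm x)\<^sup>2 * (nrm (x * c n))\<^sup>2) \<longlonglongrightarrow> (nrm x)\<^sup>2 * cmod L"
    by (intro tendsto_intros sq)
  moreover have "(cmod (\<rho> (adj x * (x * c n))))\<^sup>2 \<le> (nrm x)\<^sup>2 * (nrm (x * c n))\<^sup>2" for n
    using power_mono[OF dominated_le[OF \<rho>, of x "x * c n"], of 2] by (simp add: power_mult_distrib)
  ultimately have "(cmod L)\<^sup>2 \<le> (nrm x)\<^sup>2 * cmod L"
    by (intro tendsto_le[OF sequentially_bot]) auto
  then have L: "cmod L \<le> (nrm x)\<^sup>2"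
    by (cases "cmod L = 0") (auto simp: power2_eq_square)
  have "(\<lambda>n. (cmod (\<sigma> (adj (c n) * (adj x * y))))\<^sup>2) \<longlonglongrightarrow> (cmod (product \<rho> \<sigma> (adj x * y)))\<^sup>2"
    by (intro tendsto_intros product_tendsto c \<sigma>)
  moreover have "(\<lambda>n. (nrm (x * c n))\<^sup>2 * (nrm y)\<^sup>2) \<longlonglongrightarrow> cmod L * (nrm y)\<^sup>2"
    by (intro tendsto_intros sq)
  moreover have "(cmod (\<sigma> (adj (c n) * (adj x * y))))\<^sup>2 \<le> (nrm (x * c n))\<^sup>2 * (nrm y)\<^sup>2" for n
    using power_mono[OF dominated_le[OF \<sigma>, of "x * c n" y], of 2]
    by (simp add: power_mult_distrib adj_mult mult.assoc)
  ultimately have "(cmod (product \<rho> \<sigma> (adj x * y)))\<^sup>2 \<le> cmod L * (nrm y)\<^sup>2"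
    by (intro tendsto_le[OF sequentially_bot]) auto
  also have "\<dots> \<le> (nrm x * nrm y)\<^sup>2"
    using L by (simp add: power_mult_distrib mult_right_mono)
  finally show ?thesis by (rule power2_le_imp_le) simp
qed

text \<open>
  If \<open>T\<^sub>\<rho>\<^sup>2 = l\<close> and \<open>T\<^sub>\<rho> T\<^sub>\<sigma> = k\<close> are scalars, then \<open>l T\<^sub>\<sigma> = T\<^sub>\<rho>\<^sup>2 T\<^sub>\<sigma> = k T\<^sub>\<rho>\<close>.
\<close>

lemma proportional_of_scalar_products:
  assumes l: "\<And>x. product \<rho> \<rho> x = l * \<omega> x" and k: "\<And>x. product \<rho> \<sigma> x = k * \<omega> x"
  shows "l * \<sigma> x = k * \<rho> x"
proof -
  obtain c where c: "approximates \<omega> c \<rho>" using approximation_exists[OF \<rho>] .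
  obtain d where d: "approximates \<omega> d \<sigma>" using approximation_exists[OF \<sigma>] .
  obtain K where K: "\<And>n. nrm (c n) \<le> K" using approximates_nrm_bounded[OF c \<rho>] by blast
  obtain K' where K': "\<And>n. nrm (d n) \<le> K'" using approximates_nrm_bounded[OF d \<sigma>] by blast
  have xd: "nrm (x * d n) \<le> 2 * norm x * K'" for n
    using nrm_mult[of x "d n"] mult_left_mono[OF K'[of n], of "2 * norm x"] by simp
  have xc: "nrm (adj x * c n) \<le> 2 * norm x * K" for n
    using nrm_mult[of "adj x" "c n"] mult_left_mono[OF K[of n], of "2 * norm x"] by simp
  have "(\<lambda>n. l * \<omega> (x * d n)) \<longlonglongrightarrow> l * \<sigma> x"
    by (rule tendsto_mult_left[OF approximates_tendsto(2)[OF d \<sigma>_adj]])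
  from tendsto_diff[OF this product_tendsto_uniform[where x = "\<lambda>n. x * d n", OF c \<rho> xd]]
  have 1: "(\<lambda>n. \<rho> (adj (c n) * (x * d n))) \<longlonglongrightarrow> l * \<sigma> x" by (simp add: l)
  have 2: "(\<lambda>n. k * \<omega> (adj (c n) * x)) \<longlonglongrightarrow> k * \<rho> x"
    by (rule tendsto_mult_left[OF approximates_tendsto(1)[OF c \<rho>_adj]])
  have "product \<sigma> \<rho> (adj x * c n) = cnj (k * \<omega> (adj (c n) * x))" for n
    using dominated_pair.product_adj[OF swapped, of "adj (c n) * x"] by (simp add: adj_mult adj_adj k)
  moreover have "\<rho> (adj (d n) * (adj x * c n)) = cnj (\<rho> (adj (c n) * (x * d n)))" for n
    using \<rho>_adj[of "adj (c n) * (x * d n)"] by (simp add: adj_mult adj_adj mult.assoc)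
  ultimately have "(\<lambda>n. cnj (k * \<omega> (adj (c n) * x) - \<rho> (adj (c n) * (x * d n)))) \<longlonglongrightarrow> 0"
    using product_tendsto_uniform[where x = "\<lambda>n. adj x * c n", OF d \<rho> xc] by simp
  from tendsto_cnj[OF this]
  have "(\<lambda>n. k * \<omega> (adj (c n) * x) - \<rho> (adj (c n) * (x * d n))) \<longlonglongrightarrow> 0" by simp
  from tendsto_diff[OF 2 this] have "(\<lambda>n. \<rho> (adj (c n) * (x * d n))) \<longlonglongrightarrow> k * \<rho> x" by simp
  with 1 show ?thesis by (rule LIMSEQ_unique)
qed

lemma eq_zero_of_product_eq_zero:
  assumes "product \<rho> \<rho> 1 = 0"
  shows "\<rho> x = 0"
proof -
  obtain c where c: "approximates \<omega> c \<rho>" using approximation_exists[OF \<rho>] .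
  have "(\<lambda>n. complex_of_real ((nrm (c n))\<^sup>2)) \<longlonglongrightarrow> 0"
    using dominated_pair.product_tendsto_diagonal[OF diagonal c c, of 1]
    unfolding nrm_square[symmetric] by (simp add: assms)
  then have "(\<lambda>n. (nrm (c n))\<^sup>2) \<longlonglongrightarrow> 0"
    using tendsto_Re by fastforce
  then have "(\<lambda>n. sqrt ((nrm (c n))\<^sup>2)) \<longlonglongrightarrow> sqrt 0" by (rule tendsto_real_sqrt)
  then have "(\<lambda>n. nrm (c n)) \<longlonglongrightarrow> 0" by simp
  then have "(\<lambda>n. nrm (c n) * nrm x) \<longlonglongrightarrow> 0" by (rule tendsto_mult_left_zero)
  then have "(\<lambda>n. \<omega> (adj (c n) * x)) \<longlonglongrightarrow> 0"
    by (rule Lim_null_comparison[OF always_eventually, OF allI, rotated]) (rule Cauchy_Schwarz)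
  with approximates_tendsto(1)[OF c \<rho>_adj] show ?thesis by (rule LIMSEQ_unique)
qed

end

section \<open>Extreme points of a subset of a line\<close>

lemma extreme_points_of_subset_of_line:
  fixes S :: "'v :: real_vector set"
  assumes "S \<subseteq> range (\<lambda>r. r *\<^sub>R v)"
  shows "finite {x. x extreme_point_of S} \<and> card {x. x extreme_point_of S} \<le> 2"
proof (cases "v = 0")
  case True
  then have "{x. x extreme_point_of S} \<subseteq> {0}" using assms by (auto simp: extreme_point_of_def)
  then show ?thesis
    using finite_subset card_mono[of "{0}" "{x. x extreme_point_of S}"] by fastforce
next
  case False
  define T where "T = {r. r *\<^sub>R v \<in> S}"
  have ext: "(\<forall>s\<in>T. s \<le> r) \<or> (\<forall>s\<in>T. r \<le> s)" if r: "(r *\<^sub>R v) extreme_point_of S" for r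
  proof (rule ccontr)
    assume "\<not> ?thesis"
    then obtain s t where st: "s \<in> T" "t \<in> T" "t < r" "r < s" by (auto simp: not_le)
    define u where "u = (r - t) / (s - t)"
    have u: "0 < u" "u < 1" using st by (simp_all add: u_def)
    have "u * (s - t) = r - t" using st by (simp add: u_def)
    then have "r = (1 - u) * t + u * s" by (simp add: algebra_simps)
    then have "r *\<^sub>R v = (1 - u) *\<^sub>R (t *\<^sub>R v) + u *\<^sub>R (s *\<^sub>R v)"
      by (simp flip: scaleR_add_left)
    moreover have "t *\<^sub>R v \<noteq> s *\<^sub>R v" using False st by simp
    ultimately have "r *\<^sub>R v \<in> open_segment (t *\<^sub>R v) (s *\<^sub>R v)"
      using u unfolding in_segment by blast
    then show False using r st by (auto simp: extreme_point_of_def T_def)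
  qed
  \<comment> \<open>\<open>T\<close> may be unbounded, but its supremum or infimum is used only where it is attained.\<close>
  have "{x. x extreme_point_of S} \<subseteq> {Sup T *\<^sub>R v, Inf T *\<^sub>R v}"
  proof
    fix x assume "x \<in> {x. x extreme_point_of S}"
    then have x: "x extreme_point_of S" by simp
    then have "x \<in> S" by (simp add: extreme_point_of_def)
    moreover from this obtain r where "x = r *\<^sub>R v" using assms by blast
    ultimately have r: "x = r *\<^sub>R v" "r \<in> T" by (simp_all add: T_def)
    have "Inf T = r" if "\<forall>s\<in>T. r \<le> s" by (rule cInf_eq_minimum) (use that r in auto)
    moreover have "Sup T = r" if "\<forall>s\<in>T. s \<le> r" by (rule cSup_eq_maximum) (use that r in auto)
    ultimately show "x \<in> {Sup T *\<^sub>R v, Inf T *\<^sub>R v}" using ext[of r] x r by auto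
  qed
  from finite_subset[OF this] card_mono[OF _ this]
  have "finite {x. x extreme_point_of S}"
    "card {x. x extreme_point_of S} \<le> card {Sup T *\<^sub>R v, Inf T *\<^sub>R v}"
    by simp_all
  moreover have "card {Sup T *\<^sub>R v, Inf T *\<^sub>R v} \<le> 2"
    by (simp add: card_insert_if)
  ultimately show ?thesis by linarith
qed

section \<open>Graded KMS states\<close>

locale graded_kms_state = cstar_action \<alpha> + cstar_state \<omega>
  for \<alpha> :: "real \<Rightarrow> 'a :: unital_cstar_algebra \<Rightarrow> 'a" and \<omega> :: "'a \<Rightarrow> complex" +
  fixes \<gamma> :: "'a \<Rightarrow> 'a" and \<beta> :: real
  assumes graded: "graded_cstar_dynamical_system \<alpha> \<gamma>" and \<beta>: "\<beta> \<noteq> 0"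
    and KMS_invariant: "\<omega> \<in> invariant_KMS_states \<beta> \<alpha> \<gamma>"
begin

abbreviation ib :: complex where "ib \<equiv> \<i> * complex_of_real \<beta>"

lemma \<gamma>: "star_automorphism \<gamma>"
  using graded by (simp add: graded_cstar_dynamical_system_def)

lemmas \<gamma>_simps = star_automorphismD[OF \<gamma>]

lemma \<gamma>_\<gamma> [simp]: "\<gamma> (\<gamma> a) = a"
  using graded by (auto simp: graded_cstar_dynamical_system_def fun_eq_iff)

lemma \<gamma>_\<alpha>: "\<alpha> t (\<gamma> a) = \<gamma> (\<alpha> t a)"
  using graded by (auto simp: graded_cstar_dynamical_system_def fun_eq_iff)

lemma \<omega>_\<gamma> [simp]: "\<omega> (\<gamma> a) = \<omega> a"
  using KMS_invariant by (auto simp: invariant_KMS_states_def fun_eq_iff)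

lemma identity_automorphism: "star_automorphism (\<lambda>a :: 'a. a)"
  by (simp add: star_automorphism_def bij_id[unfolded id_def])

lemma KMS_entire:
  assumes "a \<in> entire_elements \<alpha>" "b \<in> entire_elements \<alpha>"
  shows "\<omega> (a * complex_time \<alpha> ib b) = \<omega> (b * a)"
  using KMS_invariant assms by (auto simp: invariant_KMS_states_def KMS_state_def)

lemma KMS:
  assumes "analytic_extension \<alpha> b g"
  shows "\<omega> (a * g ib) = \<omega> (b * a)"
  by (rule twisted_KMS_extend[where z = ib and \<theta> = "\<lambda>a. a", OF bounded identity_automorphism KMS_entire assms])

lemma \<omega>_\<alpha> [simp]: "\<omega> (\<alpha> t a) = \<omega> a"
  by (rule twisted_KMS_invariant(1)[where \<theta> = "\<lambda>a. a", OF bounded identity_automorphism \<beta> KMS_entire])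

lemma nrm_\<alpha> [simp]: "nrm (\<alpha> t a) = nrm a"
  by (simp add: gns_norm_def flip: \<alpha>_simps(4,5))

lemma nrm_\<gamma> [simp]: "nrm (\<gamma> a) = nrm a"
  by (simp add: gns_norm_def flip: \<gamma>_simps(4,5))

text \<open>
  Right multiplication by an entire element \<open>x\<close> is bounded on the GNS space. By the KMS condition
  \<open>\<parallel>d x\<parallel>\<^sub>\<omega>\<^sup>2 = \<omega>(d\<^sup>*d y)\<close> with \<open>y = x \<alpha>\<^bsub>\<i>\<beta>\<^esub>(x\<^sup>*)\<close>, and \<open>\<omega>(y\<^sup>*w) = \<omega>(w y)\<close> for all \<open>w\<close>. The
  Cauchy-Schwarz inequality then compares \<open>\<omega>(d\<^sup>*d y\<^sup>n)\<close> with \<open>\<omega>(d\<^sup>*d y\<^bsup>2n\<^esup>)\<close>, and iteration leaves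
  the factor \<open>\<parallel>y\<parallel>\<close>.
\<close>

lemma right_mult_bounded:
  assumes "x \<in> entire_elements \<alpha>"
  obtains C where "0 \<le> C" "\<And>d. nrm (d * x) \<le> C * nrm d"
proof -
  obtain f where f: "analytic_extension \<alpha> x f" using assms by (auto simp: entire_elements_def)
  define X where "X = adj (f (cnj ib))"
  define y where "y = x * X"
  have kmsX: "\<omega> (a * X) = \<omega> (adj x * a)" for a
    using KMS[OF extension_adj[OF f], of a] by (simp only: X_def)
  have kmsX': "\<omega> (adj X * a) = \<omega> (a * x)" for a
    using adj[of "adj a * X"] adj[of "adj x * adj a"] kmsX[of "adj a"]
    by (simp add: adj_mult adj_adj)
  have y: "\<omega> (adj y * w) = \<omega> (w * y)" for w
    using kmsX'[of "adj x * w"] kmsX[of "w * x"] by (simp add: y_def adj_mult mult.assoc)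
  have y_pow: "\<omega> (adj (y ^ n) * w) = \<omega> (w * y ^ n)" for n w
  proof (induction n arbitrary: w)
    case (Suc n)
    have "\<omega> (adj (y ^ Suc n) * w) = \<omega> (adj (y ^ n) * (adj y * w))"
      by (simp add: adj_mult mult.assoc)
    also have "\<dots> = \<omega> (adj y * (w * y ^ n))" by (simp add: Suc mult.assoc)
    also have "\<dots> = \<omega> (w * y ^ Suc n)" by (simp add: y mult.assoc flip: power_Suc2)
    finally show ?case .
  qed simp
  show ?thesis
  proof (rule that[of "sqrt (norm y)"])
    fix d
    define q where "q j = cmod (\<omega> (adj d * (d * y ^ (2 ^ j))))" for j :: nat
    have q_step: "(q j)\<^sup>2 \<le> (nrm d)\<^sup>2 * q (Suc j)" for j
    proof -
      let ?v = "y ^ (2 ^ j)"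
      have "q j \<le> nrm d * nrm (d * ?v)" unfolding q_def by (rule Cauchy_Schwarz)
      then have "(q j)\<^sup>2 \<le> (nrm d)\<^sup>2 * (nrm (d * ?v))\<^sup>2"
        using power_mono[of "q j" "nrm d * nrm (d * ?v)" 2] by (simp add: q_def power_mult_distrib)
      also have "(nrm (d * ?v))\<^sup>2 = cmod (\<omega> (adj (d * ?v) * (d * ?v)))"
        by (simp add: nrm_square norm_power)
      also have "\<dots> = cmod (\<omega> (adj ?v * (adj d * (d * ?v))))" by (simp add: adj_mult mult.assoc)
      also have "\<dots> = q (Suc j)"
        by (simp add: y_pow q_def mult.assoc power_add mult_2)
      finally show ?thesis .
    qed
    have "q 0 \<le> (nrm d)\<^sup>2 * norm y"
    proof (cases "nrm d = 0")
      case True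
      then show ?thesis using q_step[of 0] by simp
    next
      case False
      then have N: "0 < (nrm d)\<^sup>2" by simp
      have pow: "(q 0 / (nrm d)\<^sup>2) ^ (2 ^ j) \<le> q j / (nrm d)\<^sup>2" for j
      proof (induction j)
        case (Suc j)
        have "(q 0 / (nrm d)\<^sup>2) ^ (2 ^ Suc j) = ((q 0 / (nrm d)\<^sup>2) ^ (2 ^ j))\<^sup>2"
          by (simp add: power_mult mult.commute flip: power_mult)
        also have "\<dots> \<le> (q j / (nrm d)\<^sup>2)\<^sup>2"
          by (intro power_mono Suc) (simp add: q_def)
        also have "\<dots> \<le> ((nrm d)\<^sup>2 * q (Suc j)) / ((nrm d)\<^sup>2)\<^sup>2"
          using q_step[of j] by (simp add: power_divide divide_right_mono)
        also have "\<dots> = q (Suc j) / (nrm d)\<^sup>2" using N by (simp add: power2_eq_square)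
        finally show ?case .
      qed simp
      have "q 0 / (nrm d)\<^sup>2 \<le> norm y"
      proof (rule le_of_two_powers_le)
        fix j
        let ?v = "y ^ (2 ^ j)"
        have "q j \<le> nrm d * nrm (d * ?v)" unfolding q_def by (rule Cauchy_Schwarz)
        also have "\<dots> \<le> nrm d * (2 * (norm d * norm y ^ (2 ^ j)))"
        proof (intro mult_left_mono)
          have "norm (d * ?v) \<le> norm d * norm y ^ (2 ^ j)"
            using norm_mult_ineq[of d ?v] mult_left_mono[OF norm_power_ineq[of y "2 ^ j"], of "norm d"]
            by simp
          then show "nrm (d * ?v) \<le> 2 * (norm d * norm y ^ (2 ^ j))"
            using nrm_le_norm[of "d * ?v"] by linarith
        qed simp
        finally have "q j / (nrm d)\<^sup>2 \<le> nrm d * (2 * (norm d * norm y ^ (2 ^ j))) / (nrm d)\<^sup>2"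
          by (rule divide_right_mono) simp
        with pow[of j]
        show "(q 0 / (nrm d)\<^sup>2) ^ (2 ^ j) \<le> (nrm d * 2 * norm d / (nrm d)\<^sup>2) * norm y ^ (2 ^ j)"
          by (simp add: mult_ac)
      qed simp
      then show ?thesis using N by (simp add: pos_divide_le_eq mult.commute)
    qed
    moreover have "(nrm (d * x))\<^sup>2 = q 0"
    proof -
      have "\<omega> (adj (d * x) * (d * x)) = \<omega> (adj d * (d * y))"
        using kmsX[of "adj d * (d * x)"] by (simp add: adj_mult y_def mult.assoc)
      then have "cmod (complex_of_real ((nrm (d * x))\<^sup>2)) = cmod (\<omega> (adj d * (d * y)))"
        by (simp only: nrm_square)
      then show ?thesis by (simp add: q_def norm_power)
    qed
    ultimately have "(nrm (d * x))\<^sup>2 \<le> (sqrt (norm y) * nrm d)\<^sup>2"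
      by (simp add: power_mult_distrib mult.commute)
    then show "nrm (d * x) \<le> sqrt (norm y) * nrm d"
      by (rule power2_le_imp_le) simp
  qed simp
qed

definition twisted :: "('a \<Rightarrow> complex) \<Rightarrow> bool"
  where "twisted \<rho> \<longleftrightarrow> \<rho> \<in> twisted_KMS_functionals \<beta> \<alpha> \<gamma> \<omega>"

lemma twisted_dominated:
  assumes "twisted \<rho>"
  shows "dominated_by \<omega> \<rho>"
proof -
  have "cmod (\<rho> (adj a * b)) \<le> nrm a * nrm b" for a b
  proof (rule power2_le_imp_le)
    show "(cmod (\<rho> (adj a * b)))\<^sup>2 \<le> (nrm a * nrm b)\<^sup>2"
      using assms by (simp add: twisted_def twisted_KMS_functionals_def power_mult_distrib nrm_power2)
  qed simp
  then show ?thesis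
    using assms by (simp add: dominated_by_def twisted_def twisted_KMS_functionals_def)
qed

lemma twisted_adj:
  assumes "twisted \<rho>"
  shows "\<rho> (adj a) = cnj (\<rho> a)"
  using assms by (simp add: twisted_def twisted_KMS_functionals_def complex_cnj_cancel_iff)
    (metis complex_cnj_cnj)

lemma twisted_KMS_entire:
  assumes "twisted \<rho>" "a \<in> entire_elements \<alpha>" "b \<in> entire_elements \<alpha>"
  shows "\<rho> (a * complex_time \<alpha> ib b) = \<rho> (b * \<gamma> a)"
  using assms by (simp add: twisted_def twisted_KMS_functionals_def)

lemma twisted_KMS:
  assumes "twisted \<rho>" "analytic_extension \<alpha> b g"
  shows "\<rho> (a * g ib) = \<rho> (b * \<gamma> a)"
  by (rule twisted_KMS_extend[OF dominated_bounded[OF twisted_dominated[OF assms(1)]] \<gamma>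
      twisted_KMS_entire[OF assms(1)] assms(2)])

lemma twisted_invariant:
  assumes "twisted \<rho>"
  shows "\<rho> (\<alpha> t a) = \<rho> a" "\<rho> (\<gamma> a) = \<rho> a"
  using twisted_KMS_invariant[OF dominated_bounded[OF twisted_dominated[OF assms]] \<gamma> \<beta>
      twisted_KMS_entire[OF assms]] by auto

text \<open>
  The vector that represents \<open>\<rho>\<close> is invariant under the unitaries that implement \<open>\<alpha>\<close>, so an
  average of the orbit of an approximant with weights of total mass one is again an approximant.
  This includes the complex Gaussian weights that arise by continuation to complex times.
\<close>

lemma analytic_approximation:
  assumes \<rho>: "twisted \<rho>"
  shows "\<exists>c. (\<forall>n z. analytic_extension \<alpha> (c n z) (\<lambda>w. c n (w + z))) \<and>
    (\<forall>z. approximates \<omega> (\<lambda>n. c n z) \<rho>)"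
proof -
  obtain c where "approximates \<omega> c \<rho>"
    using approximation_exists[OF twisted_dominated[OF \<rho>]] .
  then obtain \<epsilon> where \<epsilon>: "\<epsilon> \<longlonglongrightarrow> 0" "\<And>n x. cmod (\<omega> (adj (c n) * x) - \<rho> x) \<le> \<epsilon> n * nrm x"
    unfolding approximates_def by blast
  define s where "s n z = gauss_smoothing \<alpha> (c n) z" for n z
  have "cmod (\<omega> (adj (s n z) * x) - \<rho> x) \<le> \<epsilon> n * gauss_weight z * nrm x" for n z x
  proof -
    define \<phi> where "\<phi> y = \<omega> (adj x * y)" for y
    define \<psi> where "\<psi> y = \<omega> ((\<rho> (adj x) *\<^sub>C 1) * y)" for y
    have \<phi>: "bounded_functional \<phi>" and \<psi>: "bounded_functional \<psi>"
      unfolding \<phi>_def \<psi>_def by (intro bounded_functional_mult_left bounded)+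
    have \<psi>_one: "\<psi> 1 = \<rho> (adj x)" by (simp add: \<psi>_def lin)
    have "cmod (\<phi> (\<alpha> t (c n)) - \<psi> (\<alpha> t 1)) \<le> \<epsilon> n * nrm x" for t
    proof -
      have "\<alpha> t (\<alpha> (- t) x) = x" using \<alpha>_add[of t "- t" x] by simp
      then have eq: "adj (\<alpha> t (c n)) * x = \<alpha> t (adj (c n) * \<alpha> (- t) x)" by (simp add: \<alpha>_simps)
      have "\<phi> (\<alpha> t (c n)) - \<psi> (\<alpha> t 1) = cnj (\<omega> (adj (\<alpha> t (c n)) * x) - \<rho> x)"
        by (simp add: \<alpha>_simps \<psi>_one twisted_adj[OF \<rho>]) (simp add: \<phi>_def form_adj[of x])
      also have "\<omega> (adj (\<alpha> t (c n)) * x) - \<rho> x = \<omega> (adj (c n) * \<alpha> (- t) x) - \<rho> (\<alpha> (- t) x)"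
        unfolding eq by (simp add: twisted_invariant[OF \<rho>])
      finally show ?thesis using \<epsilon>(2)[of n "\<alpha> (- t) x"] by (simp del: complex_cnj_diff)
    qed
    from functional_smoothing_le[OF \<phi> \<psi> this, of z]
    have "cmod (\<phi> (s n z) - \<rho> (adj x)) \<le> \<epsilon> n * nrm x * gauss_weight z"
      by (simp add: s_def functional_smoothing_one[OF \<psi>] \<psi>_one)
    moreover have "\<phi> (s n z) - \<rho> (adj x) = cnj (\<omega> (adj (s n z) * x) - \<rho> x)"
      by (simp add: twisted_adj[OF \<rho>]) (simp add: \<phi>_def form_adj[of x])
    ultimately show ?thesis by (simp add: mult_ac del: complex_cnj_diff)
  qed
  moreover have "(\<lambda>n. \<epsilon> n * gauss_weight z) \<longlonglongrightarrow> 0" for z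
    using tendsto_mult_left_zero[OF \<epsilon>(1)] .
  ultimately have "approximates \<omega> (\<lambda>n. s n z) \<rho>" for z
    unfolding approximates_def by blast
  moreover have "analytic_extension \<alpha> (s n z) (\<lambda>w. s n (w + z))" for n z
    unfolding s_def by (rule smoothing_extension)
  ultimately show ?thesis by blast
qed

section \<open>Products of twisted functionals satisfy the KMS condition\<close>

lemma twisted_pair:
  assumes "twisted \<rho>" "twisted \<sigma>"
  shows "dominated_pair \<omega> \<rho> \<sigma>"
  by unfold_locales (simp_all add: assms twisted_dominated twisted_adj)

lemma product_graded:
  assumes \<rho>: "twisted \<rho>" and \<sigma>: "twisted \<sigma>"
  shows "product \<rho> \<sigma> (\<gamma> x) = product \<rho> \<sigma> x"
proof -
  obtain c where c: "approximates \<omega> c \<rho>"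
    using approximation_exists[OF twisted_dominated[OF \<rho>]] .
  have "cmod (\<omega> (adj (\<gamma> (c n)) * x) - \<rho> x) = cmod (\<omega> (adj (c n) * \<gamma> x) - \<rho> (\<gamma> x))" for n x
  proof -
    have "adj (\<gamma> (c n)) * x = \<gamma> (adj (c n) * \<gamma> x)" by (simp add: \<gamma>_simps)
    then show ?thesis by (simp add: twisted_invariant[OF \<rho>])
  qed
  then have \<gamma>c: "approximates \<omega> (\<lambda>n. \<gamma> (c n)) \<rho>"
    using c unfolding approximates_def by (metis nrm_\<gamma>)
  have "\<sigma> (adj (\<gamma> (c n)) * \<gamma> x) = \<sigma> (adj (c n) * x)" for n
    using twisted_invariant(2)[OF \<sigma>, of "adj (c n) * x"] by (simp add: \<gamma>_simps)
  then show ?thesis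
    using product_tendsto[OF \<gamma>c twisted_dominated[OF \<sigma>], of "\<gamma> x"]
      product_tendsto[OF c twisted_dominated[OF \<sigma>], of x] by (simp add: LIMSEQ_unique)
qed

text \<open>
  Two factors of \<open>\<gamma>\<close> cancel: the twisted condition for \<open>\<rho>\<close> moves \<open>b d\<^sub>n\<close> to the left and produces
  \<open>\<gamma>(a)\<close>, the untwisted one for \<open>\<omega>\<close> moves \<open>c\<^sub>n\<^sup>* b d\<^sub>n\<close> to the right of \<open>\<gamma>(a)\<close>, and the twisted condition
  for \<open>\<sigma>\<close> brings \<open>c\<^sub>n\<^sup>* b\<close> back and turns \<open>\<gamma>(a)\<close> into \<open>a\<close>. In operator terms, \<open>T\<^sub>\<rho> U\<^sub>\<gamma>\<close> and
  \<open>T\<^sub>\<sigma> U\<^sub>\<gamma>\<close> lie in the bicommutant, hence their product \<open>T\<^sub>\<rho> T\<^sub>\<sigma>\<close> is central. Replacing \<open>\<omega>\<close> by \<open>\<rho>\<close> or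
  \<open>\<sigma>\<close> under the limit needs bounds on \<open>\<parallel>b d\<^sub>n \<gamma>(a)\<parallel>\<^sub>\<omega>\<close>, where \<open>\<gamma>(a)\<close> acts from the right.
\<close>

lemma product_KMS:
  assumes t\<rho>: "twisted \<rho>" and t\<sigma>: "twisted \<sigma>"
    and a: "a \<in> entire_elements \<alpha>" and b: "b \<in> entire_elements \<alpha>"
  shows "product \<rho> \<sigma> (a * complex_time \<alpha> ib b) = product \<rho> \<sigma> (b * a)"
proof -
  interpret dominated_pair \<omega> \<rho> \<sigma> by (rule twisted_pair[OF t\<rho> t\<sigma>])
  obtain c where c: "\<And>n z. analytic_extension \<alpha> (c n z) (\<lambda>w. c n (w + z))"
      "\<And>z. approximates \<omega> (\<lambda>n. c n z) \<rho>"
    using analytic_approximation[OF t\<rho>] by blast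
  obtain d where d: "\<And>n z. analytic_extension \<alpha> (d n z) (\<lambda>w. d n (w + z))"
      "\<And>z. approximates \<omega> (\<lambda>n. d n z) \<sigma>"
    using analytic_approximation[OF t\<sigma>] by blast
  define B where "B = complex_time \<alpha> ib b"
  define a' where "a' = \<gamma> a"
  have b_ext: "analytic_extension \<alpha> b (\<lambda>z. complex_time \<alpha> z b)"
    by (rule extension_complex_time[OF b])
  obtain f where f: "analytic_extension \<alpha> a f" using a by (auto simp: entire_elements_def)
  have a'_ext: "analytic_extension \<alpha> a' (\<lambda>z. \<gamma> (f z))"
    unfolding a'_def by (rule extension_automorphism[OF f \<gamma> \<gamma>_\<alpha>])
  obtain C where C: "0 \<le> C" "\<And>x. nrm (x * a') \<le> C * nrm x"
    using right_mult_bounded[OF extension_mem[OF a'_ext]] by blast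
  obtain C' where C': "0 \<le> C'" "\<And>x. nrm (x * adj a') \<le> C' * nrm x"
    using right_mult_bounded[OF extension_mem[OF extension_adj[OF a'_ext]]] by blast
  have d_ext: "analytic_extension \<alpha> (d n 0) (d n)" for n using d(1)[of n 0] by simp
  have c_ext: "analytic_extension \<alpha> (c n 0) (c n)" for n using c(1)[of n 0] by simp
  have cb_ext: "analytic_extension \<alpha> (adj (c n 0) * b) (\<lambda>z. adj (c n (cnj z)) * complex_time \<alpha> z b)" for n
    by (rule extension_mult[OF extension_adj[OF c_ext] b_ext])
  have 1: "\<rho> (a * B * d n ib) = \<rho> (b * d n 0 * a')" for n
    using twisted_KMS[OF t\<rho> extension_mult[OF b_ext d_ext[of n]], of a]
    by (simp add: B_def a'_def mult.assoc)
  have 2: "(\<lambda>n. \<omega> (adj (c n 0) * (b * d n 0 * a')) - \<rho> (b * d n 0 * a')) \<longlonglongrightarrow> 0"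
  proof -
    obtain K where K: "\<And>n. nrm (d n 0) \<le> K" using approximates_nrm_bounded[OF d(2) \<sigma>] by blast
    have "nrm (b * d n 0 * a') \<le> C * (2 * norm b * K)" for n
    proof -
      have "nrm (b * d n 0) \<le> 2 * norm b * K"
        using nrm_mult[of b "d n 0"] mult_left_mono[OF K[of n], of "2 * norm b"] by simp
      then show ?thesis
        using C(2)[of "b * d n 0"] mult_left_mono[OF _ C(1)] order_trans by blast
    qed
    then show ?thesis
      by (rule approximates_left[where x = "\<lambda>n. b * d n 0 * a'", OF c(2)])
  qed
  have 3: "\<omega> (adj (c n 0) * (b * d n 0 * a')) = \<omega> (a' * (adj (c n (cnj ib)) * B) * d n ib)" for n
    using KMS[OF extension_mult[OF cb_ext[of n] d_ext[of n]], of a']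
    unfolding B_def by (simp only: mult.assoc)
  have 4: "(\<lambda>n. \<omega> (a' * (adj (c n (cnj ib)) * B) * d n ib) - \<sigma> (a' * (adj (c n (cnj ib)) * B))) \<longlonglongrightarrow> 0"
  proof -
    obtain K where K: "\<And>n. nrm (c n (cnj ib)) \<le> K"
      using approximates_nrm_bounded[OF c(2) \<rho>] by blast
    have "nrm (adj (a' * (adj (c n (cnj ib)) * B))) \<le> 2 * norm (adj B) * (C' * K)" for n
    proof -
      have "nrm (c n (cnj ib) * adj a') \<le> C' * K"
        using C'(2)[of "c n (cnj ib)"] mult_left_mono[OF K[of n] C'(1)] by linarith
      then have "2 * norm (adj B) * nrm (c n (cnj ib) * adj a') \<le> 2 * norm (adj B) * (C' * K)"
        by (rule mult_left_mono) simp
      then show ?thesis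
        using nrm_mult[of "adj B" "c n (cnj ib) * adj a'"]
        by (simp only: adj_mult adj_adj mult.assoc)
    qed
    then show ?thesis
      by (rule approximates_right[where x = "\<lambda>n. a' * (adj (c n (cnj ib)) * B)", OF d(2) \<sigma>_adj])
  qed
  have 5: "\<sigma> (a' * (adj (c n (cnj ib)) * B)) = \<sigma> (adj (c n 0) * (b * a))" for n
    using twisted_KMS[OF t\<sigma> cb_ext[of n], of a'] unfolding B_def a'_def by (simp add: mult.assoc)
  have "(\<lambda>n. \<sigma> (adj (c n 0) * (b * a))) \<longlonglongrightarrow> product \<rho> \<sigma> (b * a)"
    by (rule product_tendsto[OF c(2) \<sigma>])
  from tendsto_diff[OF tendsto_add[OF this 4[unfolded 5]] 2[unfolded 3]]
  have "(\<lambda>n. \<rho> (a * B * d n ib)) \<longlonglongrightarrow> product \<rho> \<sigma> (b * a)"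
    by (simp add: 1)
  moreover have "(\<lambda>n. \<rho> (a * B * d n ib)) \<longlonglongrightarrow> product \<rho> \<sigma> (a * B)"
    by (rule product_tendsto_right[OF d(2)])
  ultimately show ?thesis unfolding B_def by (rule LIMSEQ_unique[rotated])
qed

end

section \<open>Consequences of extremality\<close>

text \<open>
  Extremality is used through the perturbations \<open>\<omega> \<plusminus> \<kappa>/2\<close>, which after normalisation are again
  invariant KMS states and have \<open>\<omega>\<close> on the segment between them.
\<close>

locale extremal_graded_kms_state = graded_kms_state +
  assumes extremal: "\<omega> extreme_point_of invariant_KMS_states \<beta> \<alpha> \<gamma>"
begin

lemma hermitian_KMS_functional_scalar:
  assumes lin\<kappa>: "linear_functional \<kappa>" and herm: "\<And>a. \<kappa> (adj a) = cnj (\<kappa> a)"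
    and le: "\<And>a. cmod (\<kappa> (adj a * a)) \<le> (nrm a)\<^sup>2"
    and KMS\<kappa>: "\<And>a b. a \<in> entire_elements \<alpha> \<Longrightarrow> b \<in> entire_elements \<alpha> \<Longrightarrow>
        \<kappa> (a * complex_time \<alpha> ib b) = \<kappa> (b * a)"
    and \<kappa>\<gamma>: "\<And>a. \<kappa> (\<gamma> a) = \<kappa> a"
  shows "\<kappa> x = \<kappa> 1 * \<omega> x"
proof -
  note lin' = linear_functionalD[OF lin\<kappa>]
  define k where "k = Re (\<kappa> 1)"
  have k: "\<kappa> 1 = complex_of_real k"
    using herm[of 1] by (simp add: k_def complex_eq_iff)
  have "\<bar>k\<bar> \<le> 1" using le[of 1] by (simp add: k)
  define \<omega>' where "\<omega>' s a = (\<omega> a + complex_of_real s * \<kappa> a) / complex_of_real (1 + s * k)" for s :: real and a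
  have mem: "\<omega>' s \<in> invariant_KMS_states \<beta> \<alpha> \<gamma>" if s: "\<bar>s\<bar> = 1 / 2" for s
  proof -
    have "\<bar>s * k\<bar> \<le> 1 / 2" using \<open>\<bar>k\<bar> \<le> 1\<close> unfolding abs_mult s by simp
    then have den: "0 < 1 + s * k" by linarith
    have "linear_functional (\<omega>' s)"
      by (simp add: linear_functional_def \<omega>'_def lin lin' algebra_simps add_divide_distrib)
    moreover have "\<omega>' s (adj a * a) \<in> \<real>\<^sub>\<ge>\<^sub>0" for a
    proof -
      define r where "r = Re (\<kappa> (adj a * a))"
      have r: "\<kappa> (adj a * a) = complex_of_real r"
        using herm[of "adj a * a"] by (simp add: r_def complex_eq_iff adj_mult adj_adj)
      have "\<bar>s * r\<bar> \<le> (nrm a)\<^sup>2"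
        using le[of a] unfolding abs_mult s r by simp
      then have "0 \<le> ((nrm a)\<^sup>2 + s * r) / (1 + s * k)" using den by (intro divide_nonneg_pos) linarith+
      moreover have "\<omega>' s (adj a * a) = complex_of_real (((nrm a)\<^sup>2 + s * r) / (1 + s * k))"
        by (simp add: \<omega>'_def nrm_square r)
      ultimately show ?thesis by (simp only: nonneg_Reals_of_real_iff)
    qed
    moreover have "\<omega>' s 1 = 1"
    proof -
      have "complex_of_real (1 + s * k) \<noteq> 0" using den by (simp only: of_real_eq_0_iff)
      then show ?thesis by (simp add: \<omega>'_def k)
    qed
    ultimately have "state (\<omega>' s)" by (simp add: state_def)
    moreover have "\<omega>' s (a * complex_time \<alpha> ib b) = \<omega>' s (b * a)"
      if "a \<in> entire_elements \<alpha>" "b \<in> entire_elements \<alpha>" for a b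
      using KMS_entire[OF that] KMS\<kappa>[OF that] by (simp add: \<omega>'_def)
    moreover have "\<omega>' s \<circ> \<gamma> = \<omega>' s" by (simp add: fun_eq_iff \<omega>'_def \<kappa>\<gamma>)
    ultimately show ?thesis by (simp add: invariant_KMS_states_def KMS_state_def)
  qed
  define u where "u = (1 - k / 2) / 2"
  have u: "0 < u" "u < 1" using \<open>\<bar>k\<bar> \<le> 1\<close> by (auto simp: u_def)
  have "\<omega> = (1 - u) *\<^sub>R \<omega>' (1 / 2) + u *\<^sub>R \<omega>' (- 1 / 2)"
  proof
    fix a
    have den: "1 + 1 / 2 * k = 2 * (1 - u)" "1 + (- 1 / 2) * k = 2 * u"
      by (simp_all add: u_def field_simps)
    have nz: "complex_of_real (1 - u) \<noteq> 0" "complex_of_real u \<noteq> 0"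
      using u unfolding of_real_eq_0_iff by simp_all
    have "complex_of_real (1 - u) * \<omega>' (1 / 2) a = (\<omega> a + \<kappa> a / 2) / 2"
      unfolding \<omega>'_def den of_real_mult using nz(1) by (simp del: of_real_diff)
    moreover have "complex_of_real u * \<omega>' (- 1 / 2) a = (\<omega> a - \<kappa> a / 2) / 2"
      unfolding \<omega>'_def den of_real_mult using nz(2) by simp
    ultimately show "\<omega> a = ((1 - u) *\<^sub>R \<omega>' (1 / 2) + u *\<^sub>R \<omega>' (- 1 / 2)) a"
      by (simp only: plus_fun_apply scaleR_fun_apply scaleR_conv_of_real) (simp add: field_simps)
  qed
  moreover have "\<omega> \<notin> open_segment (\<omega>' (1 / 2)) (\<omega>' (- 1 / 2))"
    using extremal mem by (simp add: extreme_point_of_def)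
  ultimately have "\<omega>' (1 / 2) = \<omega>' (- 1 / 2)"
    using u unfolding in_segment by blast
  with \<open>\<omega> = _\<close> have "\<omega> = \<omega>' (1 / 2)"
    by (metis scaleR_add_left scaleR_one diff_add_cancel)
  then have "\<omega> x = \<omega>' (1 / 2) x" by metis
  moreover have "complex_of_real (1 + 1 / 2 * k) \<noteq> 0"
    using \<open>\<bar>k\<bar> \<le> 1\<close> unfolding of_real_eq_0_iff by linarith
  ultimately have "\<omega> x * complex_of_real (1 + 1 / 2 * k) = \<omega> x + complex_of_real (1 / 2) * \<kappa> x"
    unfolding \<omega>'_def using nonzero_eq_divide_eq by blast
  then show ?thesis by (simp add: k algebra_simps)
qed

text \<open>
  The real and imaginary parts of a product of two self-adjoint elements are
  \<open>(T\<^sub>\<rho> T\<^sub>\<sigma> + T\<^sub>\<sigma> T\<^sub>\<rho>) / 2\<close> and \<open>(T\<^sub>\<rho> T\<^sub>\<sigma> - T\<^sub>\<sigma> T\<^sub>\<rho>) / 2 \<i>\<close>; both define hermitian functionals.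
\<close>

lemma product_scalar:
  assumes t\<rho>: "twisted \<rho>" and t\<sigma>: "twisted \<sigma>"
  shows "product \<rho> \<sigma> x = product \<rho> \<sigma> 1 * \<omega> x"
proof -
  interpret dominated_pair \<omega> \<rho> \<sigma> by (rule twisted_pair[OF t\<rho> t\<sigma>])
  interpret swap: dominated_pair \<omega> \<sigma> \<rho> by (rule swapped)
  note lin1 = linear_functionalD[OF product_linear]
  note lin2 = linear_functionalD[OF swap.product_linear]
  define \<kappa>1 where "\<kappa>1 a = (product \<rho> \<sigma> a + product \<sigma> \<rho> a) / 2" for a
  define \<kappa>2 where "\<kappa>2 a = (product \<rho> \<sigma> a - product \<sigma> \<rho> a) / (2 * \<i>)" for a
  have le: "cmod (product \<rho> \<sigma> (adj a * a)) \<le> (nrm a)\<^sup>2" "cmod (product \<sigma> \<rho> (adj a * a)) \<le> (nrm a)\<^sup>2" for a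
    using product_le[of a a] swap.product_le[of a a] by (simp_all add: power2_eq_square)
  have "\<kappa>1 x = \<kappa>1 1 * \<omega> x"
  proof (rule hermitian_KMS_functional_scalar)
    show "linear_functional \<kappa>1"
      by (simp add: linear_functional_def \<kappa>1_def lin1 lin2 field_simps)
    show "\<kappa>1 (adj a) = cnj (\<kappa>1 a)" for a by (simp add: \<kappa>1_def product_adj swap.product_adj)
    show "cmod (\<kappa>1 (adj a * a)) \<le> (nrm a)\<^sup>2" for a
      using norm_triangle_ineq[of "product \<rho> \<sigma> (adj a * a)" "product \<sigma> \<rho> (adj a * a)"] le[of a]
      by (simp add: \<kappa>1_def norm_divide)
  qed (simp_all add: \<kappa>1_def product_KMS product_graded t\<rho> t\<sigma>)
  moreover have "\<kappa>2 x = \<kappa>2 1 * \<omega> x"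
  proof (rule hermitian_KMS_functional_scalar)
    show "linear_functional \<kappa>2"
      by (simp add: linear_functional_def \<kappa>2_def lin1 lin2 field_simps)
    show "\<kappa>2 (adj a) = cnj (\<kappa>2 a)" for a by (simp add: \<kappa>2_def product_adj swap.product_adj field_simps)
    show "cmod (\<kappa>2 (adj a * a)) \<le> (nrm a)\<^sup>2" for a
      using norm_triangle_ineq4[of "product \<rho> \<sigma> (adj a * a)" "product \<sigma> \<rho> (adj a * a)"] le[of a]
      by (simp add: \<kappa>2_def norm_divide norm_mult)
  qed (simp_all add: \<kappa>2_def product_KMS product_graded t\<rho> t\<sigma>)
  moreover have "product \<rho> \<sigma> a = \<kappa>1 a + \<i> * \<kappa>2 a" for a
    by (simp add: \<kappa>1_def \<kappa>2_def field_simps)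
  ultimately show ?thesis by (simp add: distrib_right mult.assoc)
qed

text \<open>
  If \<open>\<rho> \<noteq> 0\<close>, then \<open>T\<^sub>\<rho>\<^sup>2\<close> is a non-zero scalar, so every other \<open>T\<^sub>\<sigma>\<close> is a multiple of \<open>T\<^sub>\<rho>\<close>; the
  factor is real because both are self-adjoint.
\<close>

lemma twisted_functionals_in_real_line:
  "\<exists>\<rho>. twisted_KMS_functionals \<beta> \<alpha> \<gamma> \<omega> \<subseteq> range (\<lambda>r. r *\<^sub>R \<rho>)"
proof (cases "\<exists>\<rho>. twisted \<rho> \<and> \<rho> \<noteq> 0")
  case False
  then have "twisted_KMS_functionals \<beta> \<alpha> \<gamma> \<omega> \<subseteq> range (\<lambda>r. r *\<^sub>R (0 :: 'a \<Rightarrow> complex))"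
    by (auto simp: twisted_def)
  then show ?thesis by blast
next
  case True
  then obtain \<rho> where t\<rho>: "twisted \<rho>" "\<rho> \<noteq> 0" by blast
  then obtain y where y: "\<rho> y \<noteq> 0" by (auto simp: fun_eq_iff)
  interpret \<rho>\<rho>: dominated_pair \<omega> \<rho> \<rho> by (rule twisted_pair[OF t\<rho>(1) t\<rho>(1)])
  have l: "product \<rho> \<rho> 1 \<noteq> 0" using \<rho>\<rho>.eq_zero_of_product_eq_zero y by blast
  have "\<sigma> \<in> range (\<lambda>r. r *\<^sub>R \<rho>)" if "twisted \<sigma>" for \<sigma>
  proof -
    interpret dominated_pair \<omega> \<rho> \<sigma> by (rule twisted_pair[OF t\<rho>(1) that])
    define k where "k = product \<rho> \<sigma> 1 / product \<rho> \<rho> 1"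
    have \<sigma>_eq: "\<sigma> x = k * \<rho> x" for x
      using proportional_of_scalar_products[OF product_scalar[OF t\<rho>(1) t\<rho>(1)]
          product_scalar[OF t\<rho>(1) that], of x] l
      by (simp add: k_def field_simps)
    have "k * cnj (\<rho> y) = cnj (k * \<rho> y)"
      using \<sigma>_adj[of y] unfolding \<sigma>_eq \<rho>_adj .
    then have "k = cnj k" using y by simp
    then have "k = complex_of_real (Re k)" by (simp add: complex_eq_iff)
    then have "\<sigma> = Re k *\<^sub>R \<rho>"
      using \<sigma>_eq by (auto simp: fun_eq_iff scaleR_conv_of_real)
    then show ?thesis by blast
  qed
  then show ?thesis by (auto simp: twisted_def)
qed

end

theorem corollary2p16:
  fixes \<alpha> :: "real \<Rightarrow> 'a :: unital_cstar_algebra \<Rightarrow> 'a"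
    and \<gamma> :: "'a \<Rightarrow> 'a"
    and \<beta> :: real
    and \<omega> :: "'a \<Rightarrow> complex"
  assumes "graded_cstar_dynamical_system \<alpha> \<gamma>"
    and "\<beta> \<noteq> 0"
    and "\<omega> extreme_point_of invariant_KMS_states \<beta> \<alpha> \<gamma>"
  shows "finite {\<rho>. \<rho> extreme_point_of twisted_KMS_functionals \<beta> \<alpha> \<gamma> \<omega>} \<and>
    card {\<rho>. \<rho> extreme_point_of twisted_KMS_functionals \<beta> \<alpha> \<gamma> \<omega>} \<le> 2"
proof -
  have mem: "\<omega> \<in> invariant_KMS_states \<beta> \<alpha> \<gamma>"
    using assms(3) by (simp add: extreme_point_of_def)
  interpret extremal_graded_kms_state \<alpha> \<omega> \<gamma> \<beta>
  proof
    show "strongly_continuous_action \<alpha>"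
      using assms(1) by (simp add: graded_cstar_dynamical_system_def)
    show "state \<omega>"
      using mem by (simp add: invariant_KMS_states_def KMS_state_def)
  qed (rule assms mem)+
  obtain \<rho> where "twisted_KMS_functionals \<beta> \<alpha> \<gamma> \<omega> \<subseteq> range (\<lambda>r. r *\<^sub>R \<rho>)"
    using twisted_functionals_in_real_line by blast
  then show ?thesis by (rule extreme_points_of_subset_of_line)
qed

end
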